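(* Let $G$ be a $CD1$-group and let $a^G,b^G$ be special classes of $G$, with $\chi_j(a)\ne\chi_j(b)$ and $\chi_i(a)=\chi_i(b)$ for all $i\neq j$. Then one of the two classes is $\{1\}$, and hence (interchanging the names if necessary) we may assume that $a=1$, so that $a_i=\chi_i(1)$ for all $i$. With this convention and $b_i=\chi_i(b)$, $g=|G|$, we have $$j=k,\qquad a_k>a_{k-1}\ge 1,$$ $b_k$ is an integer satisfying $-a_k\le b_k\le -1$, $$g=a_k^2-b_ka_k,\qquad a_k^2+a_k\le g\le 2a_k^2,$$ and $$\{1\}\cup b^G\subseteq\bigcap_{i=1}^{k-1}\ker\chi_i .$$
   Context: All groups are finite. Let $\mathrm{Irr}(G)=\{\chi_1,\dots,\chi_k\}$ be the set of complex irreducible characters of $G$, with $\chi_1=1_G$ and $\chi_1(1)=1\le\chi_2(1)\le\dots\le\chi_k(1)$. The conjugacy class of $x$ in $G$ is denoted $x^G$. A group $G$ is a $CD1$-group if $|G|>2$ and two columns of its character table differ by exactly one entry; that is, there are $a,b\in G$ and an index $j$ with $\chi_j(a)\ne\chi_j(b)$ and $\chi_i(a)=\chi_i(b)$ for all $i\ne j$. Two such classes $a^G,b^G$ are called special classes. Write $a_i=\chi_i(a)$ and $b_i=\chi_i(b)$. *)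

theory Defs
  imports
    "HOL-Algebra.Coset"
    "HOL-Library.Complex_Order"
    "Jordan_Normal_Form.Matrix"
    "Jordan_Normal_Form.VS_Connect"
begin

text \<open>
  Inequalities between complex numbers below and in the theorem are those of
  \<^theory>\<open>HOL-Library.Complex_Order\<close>: \<open>x \<le> y\<close> says that \<open>x\<close> and \<open>y\<close> have the same imaginary
  part and that the real part of \<open>x\<close> is at most that of \<open>y\<close>. Hence comparing a character value
  with a real number includes the claim that the value is real.
\<close>

abbreviation general_linear_group :: "nat \<Rightarrow> complex mat monoid" where
  "general_linear_group n \<equiv> units_of (ring_mat TYPE(complex) n ())"

definition representation ::
    "('g, 'm) monoid_scheme \<Rightarrow> nat \<Rightarrow> ('g \<Rightarrow> complex mat) \<Rightarrow> bool" where
  "representation G n \<rho> \<longleftrightarrow> \<rho> \<in> hom G (general_linear_group n)"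

definition irreducible_representation ::
    "('g, 'm) monoid_scheme \<Rightarrow> nat \<Rightarrow> ('g \<Rightarrow> complex mat) \<Rightarrow> bool" where
  "irreducible_representation G n \<rho> \<longleftrightarrow>
     representation G n \<rho> \<and> n > 0 \<and>
     (\<forall>W. VectorSpace.subspace class_ring W (module_vec TYPE(complex) n) \<and>
          (\<forall>g\<in>carrier G. \<forall>w\<in>W. \<rho> g *\<^sub>v w \<in> W) \<longrightarrow>
          W = {0\<^sub>v n} \<or> W = carrier_vec n)"

text \<open>
  Class functions are made extensional (\<open>undefined\<close> outside the carrier), so that distinct
  elements of \<open>Irr G\<close> are distinct as functions on the group.
\<close>

definition character_of ::
    "('g, 'm) monoid_scheme \<Rightarrow> nat \<Rightarrow> ('g \<Rightarrow> complex mat) \<Rightarrow> 'g \<Rightarrow> complex" where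
  "character_of G n \<rho> = (\<lambda>g\<in>carrier G. \<Sum>i<n. \<rho> g $$ (i, i))"

definition Irr :: "('g, 'm) monoid_scheme \<Rightarrow> ('g \<Rightarrow> complex) set" where
  "Irr G = {character_of G n \<rho> | n \<rho>. irreducible_representation G n \<rho>}"

definition principal_character :: "('g, 'm) monoid_scheme \<Rightarrow> 'g \<Rightarrow> complex" where
  "principal_character G = (\<lambda>g\<in>carrier G. 1)"

definition char_kernel :: "('g, 'm) monoid_scheme \<Rightarrow> ('g \<Rightarrow> complex) \<Rightarrow> 'g set" where
  "char_kernel G f = {g \<in> carrier G. f g = f \<one>\<^bsub>G\<^esub>}"

definition conj_class :: "('g, 'm) monoid_scheme \<Rightarrow> 'g \<Rightarrow> 'g set" where
  "conj_class G x = {inv\<^bsub>G\<^esub> g \<otimes>\<^bsub>G\<^esub> x \<otimes>\<^bsub>G\<^esub> g | g. g \<in> carrier G}"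

definition CD1_group :: "('g, 'm) monoid_scheme \<Rightarrow> bool" where
  "CD1_group G \<longleftrightarrow>
     group G \<and> finite (carrier G) \<and> Coset.order G > 2 \<and>
     (\<exists>a\<in>carrier G. \<exists>b\<in>carrier G. \<exists>f\<in>Irr G.
        f a \<noteq> f b \<and> (\<forall>h\<in>Irr G - {f}. h a = h b))"

text \<open>
  The standing enumeration \<open>\<chi>\<^sub>1, \<dots>, \<chi>\<^sub>k\<close> of \<open>Irr G\<close>. It is indexed from 1; values of \<open>chi\<close> at
  other indices are irrelevant.
\<close>

definition Irr_enumeration ::
    "('g, 'm) monoid_scheme \<Rightarrow> nat \<Rightarrow> (nat \<Rightarrow> 'g \<Rightarrow> complex) \<Rightarrow> bool" where
  "Irr_enumeration G k chi \<longleftrightarrow>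
     bij_betw chi {1..k} (Irr G) \<and>
     chi 1 = principal_character G \<and>
     (\<forall>i\<in>{1..k}. \<forall>i'\<in>{1..k}. i \<le> i' \<longrightarrow> chi i \<one>\<^bsub>G\<^esub> \<le> chi i' \<one>\<^bsub>G\<^esub>)"

end

theory Submission
  imports
    Defs
    "HOL-Algebra.Multiplicative_Group"
    "Jordan_Normal_Form.Schur_Decomposition"
    "Jordan_Normal_Form.Spectral_Radius"
begin

text \<open>
  Everything rests on one formula, the decomposition of the regular character:
  \<open>\<Sum>\<chi>\<in>Irr G. \<chi>(1) \<chi>(x)\<close> is \<open>|G|\<close> for \<open>x = 1\<close> and \<open>0\<close> for every other \<open>x\<close>
  (\<open>regular_character_decomposition\<close>).

  If neither \<open>a\<close> nor \<open>b\<close> were \<open>1\<close>, subtracting the formula for \<open>b\<close> from the one for \<open>a\<close>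
  would cancel all terms but \<open>\<chi>\<^sub>j(1) (\<chi>\<^sub>j(a) - \<chi>\<^sub>j(b))\<close>, which is not zero. So one of the two, say
  \<open>a\<close>, is \<open>1\<close>. Let \<open>S\<close> be the sum of the \<open>\<chi>\<^sub>i(1)\<^sup>2\<close> over \<open>i \<noteq> j\<close>. The formula at \<open>1\<close> and at \<open>b\<close> reads
  \<open>|G| = \<chi>\<^sub>j(1)\<^sup>2 + S\<close> and \<open>0 = \<chi>\<^sub>j(1) \<chi>\<^sub>j(b) + S\<close>. The principal character contributes 1 to \<open>S\<close>, so
  \<open>\<chi>\<^sub>j(b) < 0\<close>, while \<open>|\<chi>\<^sub>j(b)| \<le> \<chi>\<^sub>j(1)\<close> gives \<open>S \<le> \<chi>\<^sub>j(1)\<^sup>2\<close>. Hence every other degree is smaller than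
  \<open>\<chi>\<^sub>j(1)\<close>, where \<open>|G| > 2\<close> excludes \<open>\<chi>\<^sub>j(1) = 1\<close>; this is \<open>j = k\<close>.

  Integrality of \<open>\<chi>\<^sub>j(b)\<close> comes from counting eigenvalues. All \<open>\<chi>\<^sub>i\<close> with \<open>i \<noteq> j\<close> have \<open>b\<close> in their
  kernel, hence also every power of \<open>b\<close>. The formula then forces \<open>\<chi>\<^sub>j\<close> to take one and the same
  value \<open>\<beta>\<close> at all nontrivial powers of \<open>b\<close>. The eigenvalues of a matrix representing \<open>b\<close> are roots
  of unity whose power sums are therefore constant, and comparing the multiplicities of the
  eigenvalue 1 and of any other eigenvalue shows that \<open>\<beta>\<close> is a difference of two natural numbers
  (\<open>power_sums_constant_imp_integer\<close>).

  The regular character decomposes because every character is a sum of irreducible ones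
  (\<open>character_sum_of_irreducibles\<close>), and the multiplicities are read off from the orthogonality
  relations (\<open>irreducible_characters_orthonormal\<close>), which come from Schur's lemma. The summands of a
  character belong to the composition factors of a representation: an invariant subspace makes the
  matrices block triangular, and the trace only sees the diagonal blocks.
\<close>

section \<open>Matrices and coordinates adapted to a subspace\<close>

lemma subspace_vec_iff:
  "VectorSpace.subspace class_ring W (module_vec TYPE('a::field) n) \<longleftrightarrow>
     W \<subseteq> carrier_vec n \<and> 0\<^sub>v n \<in> W \<and> (\<forall>v\<in>W. \<forall>w\<in>W. v + w \<in> W) \<and> (\<forall>c. \<forall>v\<in>W. c \<cdot>\<^sub>v v \<in> W)"
  unfolding VectorSpace.subspace_def submodule_def module_vec_simps
  using vec_vs[of n, where 'a = 'a] vec_module[of n, where 'a = 'a] by (auto simp: class_ring_simps)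

lemma mult_mat_vec_index_sum:
  assumes "A \<in> carrier_mat m n" "v \<in> carrier_vec n" "i < m"
  shows "(A *\<^sub>v v) $ i = (\<Sum>l<n. A $$ (i, l) * v $ l)"
  using assms by (auto simp: scalar_prod_def lessThan_atLeast0 intro!: sum.cong)

lemma mult_mat_index_sum:
  assumes "A \<in> carrier_mat m n" "B \<in> carrier_mat n p" "i < m" "j < p"
  shows "(A * B) $$ (i, j) = (\<Sum>l<n. A $$ (i, l) * B $$ (l, j))"
  using assms by (auto simp: scalar_prod_def lessThan_atLeast0 intro!: sum.cong)

definition mat_trace :: "'a::comm_semiring_0 mat \<Rightarrow> 'a" where
  "mat_trace A = (\<Sum>i<dim_row A. A $$ (i, i))"

lemma mat_trace_comm:
  assumes A: "A \<in> carrier_mat n m" and B: "B \<in> carrier_mat m n"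
  shows "mat_trace (A * B) = mat_trace (B * A)"
proof -
  have "mat_trace (A * B) = (\<Sum>i<n. \<Sum>l<m. A $$ (i, l) * B $$ (l, i))"
    using A B by (simp add: mat_trace_def mult_mat_index_sum[OF A B] del: index_mult_mat(1))
  also have "\<dots> = (\<Sum>l<m. \<Sum>i<n. B $$ (l, i) * A $$ (i, l))"
    by (subst sum.swap) (simp add: mult.commute)
  also have "\<dots> = mat_trace (B * A)"
    using A B by (simp add: mat_trace_def mult_mat_index_sum[OF B A] del: index_mult_mat(1))
  finally show ?thesis .
qed

lemma mat_trace_conjugate:
  fixes A :: "'a::comm_semiring_1 mat"
  assumes "A \<in> carrier_mat n n" "T \<in> carrier_mat m n" "S \<in> carrier_mat n m" "S * T = 1\<^sub>m n"
  shows "mat_trace (T * A * S) = mat_trace A"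
proof -
  have "mat_trace (T * A * S) = mat_trace (S * (T * A))"
    using assms by (intro mat_trace_comm[of _ m n]) auto
  also have "S * (T * A) = S * T * A"
    by (rule assoc_mult_mat[symmetric, OF assms(3,2,1)])
  also have "\<dots> = A"
    using assms by simp
  finally show ?thesis .
qed

lemma mat_eq_if_mult_vec_eq:
  fixes A :: "'a::semiring_1 mat"
  assumes A: "A \<in> carrier_mat m n" and B: "B \<in> carrier_mat m n"
    and eq: "\<And>v. v \<in> carrier_vec n \<Longrightarrow> A *\<^sub>v v = B *\<^sub>v v"
  shows "A = B"
proof (rule eq_matI)
  fix i j assume "i < dim_row B" "j < dim_col B"
  then have ij: "i < m" "j < n" using B by auto
  have *: "C $$ (i, j) = (C *\<^sub>v unit_vec n j) $ i" if "C \<in> carrier_mat m n" for C :: "'a mat"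
    using that ij by (auto simp: scalar_prod_right_unit)
  show "A $$ (i, j) = B $$ (i, j)" using *[OF A] *[OF B] eq by simp
qed (use A B in auto)

lemma mat_eq_0_if_kills_all:
  fixes A :: "'a::semiring_1 mat"
  assumes A: "A \<in> carrier_mat m n" and kills: "\<And>v. v \<in> carrier_vec n \<Longrightarrow> A *\<^sub>v v = 0\<^sub>v m"
  shows "A = 0\<^sub>m m n"
proof (rule mat_eq_if_mult_vec_eq[OF A])
  fix v :: "'a vec" assume v: "v \<in> carrier_vec n"
  have "0\<^sub>m m n *\<^sub>v v = 0\<^sub>v m"
    using v by (intro eq_vecI) (auto simp: scalar_prod_def)
  then show "A *\<^sub>v v = 0\<^sub>m m n *\<^sub>v v" using kills[OF v] by simp
qed simp

lemma mat_inverse_if_bijective: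
  fixes T :: "'a::comm_ring_1 mat"
  assumes T: "T \<in> carrier_mat m n"
    and inj: "\<And>v. v \<in> carrier_vec n \<Longrightarrow> T *\<^sub>v v = 0\<^sub>v m \<Longrightarrow> v = 0\<^sub>v n"
    and surj: "\<And>w. w \<in> carrier_vec m \<Longrightarrow> \<exists>v\<in>carrier_vec n. T *\<^sub>v v = w"
  obtains S where "S \<in> carrier_mat n m" "S * T = 1\<^sub>m n" "T * S = 1\<^sub>m m"
proof -
  define f where "f i = (SOME v. v \<in> carrier_vec n \<and> T *\<^sub>v v = unit_vec m i)" for i
  have f: "f i \<in> carrier_vec n \<and> T *\<^sub>v f i = unit_vec m i" for i
    unfolding f_def by (rule someI_ex) (use surj[of "unit_vec m i"] in auto)
  define S where "S = mat n m (\<lambda>(i, j). f j $ i)"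
  have S: "S \<in> carrier_mat n m" by (simp add: S_def)
  have colS: "col S j = f j" if "j < m" for j
    using that f[of j] by (auto simp: S_def)
  have TS: "T * S = 1\<^sub>m m"
  proof (rule mat_col_eqI)
    fix j assume "j < dim_col (1\<^sub>m m :: 'a mat)"
    then have j: "j < m" by simp
    have "col (T * S) j = T *\<^sub>v col S j" by (rule col_mult2[OF T S j])
    then show "col (T * S) j = col (1\<^sub>m m) j" using f[of j] colS[OF j] j by simp
  qed (use T S in auto)
  have "S * T = 1\<^sub>m n"
  proof (rule mat_eq_if_mult_vec_eq)
    fix v :: "'a vec" assume v: "v \<in> carrier_vec n"
    define w where "w = S *\<^sub>v (T *\<^sub>v v) - v"
    have w: "w \<in> carrier_vec n" using S T v by (auto simp: w_def)
    have "T *\<^sub>v w = T *\<^sub>v (S *\<^sub>v (T *\<^sub>v v)) - T *\<^sub>v v"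
      unfolding w_def by (rule mult_minus_distrib_mat_vec[OF T]) (use S T v in auto)
    also have "T *\<^sub>v (S *\<^sub>v (T *\<^sub>v v)) = T *\<^sub>v v"
      using S T v TS by (subst assoc_mult_mat_vec[symmetric, of _ m n _ m]) auto
    finally have "T *\<^sub>v w = 0\<^sub>v m" using T v by auto
    with inj w have w0: "w = 0\<^sub>v n" by blast
    have "S *\<^sub>v (T *\<^sub>v v) = v"
    proof (rule eq_vecI)
      fix i assume i: "i < dim_vec v"
      have "w $ i = 0" using w0 i v by simp
      then show "(S *\<^sub>v (T *\<^sub>v v)) $ i = v $ i"
        unfolding w_def using i v S T by simp
    qed (use S v in auto)
    then show "(S * T) *\<^sub>v v = 1\<^sub>m n *\<^sub>v v"
      using S T v by (subst assoc_mult_mat_vec[of _ n m _ n]) auto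
  qed (use S T in auto)
  with S TS show thesis using that by blast
qed

text \<open>
  The matrices \<open>1 + y e\<^sub>l\<^sup>T\<close> compose by \<open>(1 + x e\<^sub>l\<^sup>T) (1 + y e\<^sub>l\<^sup>T) = 1 + (x + y + y\<^sub>l x) e\<^sub>l\<^sup>T\<close>,
  so \<open>x = - y / (1 + y\<^sub>l)\<close> gives the inverse on either side.
\<close>

lemma elementary_column_inverse:
  fixes y :: "nat \<Rightarrow> 'a::field"
  assumes l: "l < n" and y: "1 + y l \<noteq> 0"
  defines "E \<equiv> \<lambda>z. mat n n (\<lambda>(i, j). (if i = j then 1 else 0) + (if j = l then z i else 0))"
  shows "E (\<lambda>i. - y i / (1 + y l)) * E y = 1\<^sub>m n" "E y * E (\<lambda>i. - y i / (1 + y l)) = 1\<^sub>m n"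
proof -
  have prod: "E x * E z = 1\<^sub>m n" if "\<And>i. x i + z i + x i * z l = 0" for x z
  proof (rule eq_matI)
    fix i j assume "i < dim_row (1\<^sub>m n :: 'a mat)" "j < dim_col (1\<^sub>m n :: 'a mat)"
    then have ij: "i < n" "j < n" by auto
    have "(E x * E z) $$ (i, j) = (\<Sum>h<n. E x $$ (i, h) * E z $$ (h, j))"
      by (rule mult_mat_index_sum[of _ n n _ n]) (use ij in \<open>auto simp: E_def\<close>)
    also have "\<dots> = (\<Sum>h<n. (if i = h then (if h = j then 1 else 0) + (if j = l then z h else 0) else 0)
                        + (if h = l then x i * ((if h = j then 1 else 0) + (if j = l then z h else 0)) else 0))"
      by (rule sum.cong) (use ij in \<open>auto simp: E_def algebra_simps\<close>)
    also have "\<dots> = (if i = j then 1 else 0) + (if j = l then z i else 0)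
                     + x i * ((if l = j then 1 else 0) + (if j = l then z l else 0))"
      using ij l by (simp add: sum.distrib sum.delta sum.delta')
    also have "\<dots> = (if i = j then 1 else 0)"
      using that[of i] by (auto simp: algebra_simps)
    finally show "(E x * E z) $$ (i, j) = 1\<^sub>m n $$ (i, j)" using ij by simp
  qed (auto simp: E_def)
  show "E (\<lambda>i. - y i / (1 + y l)) * E y = 1\<^sub>m n" "E y * E (\<lambda>i. - y i / (1 + y l)) = 1\<^sub>m n"
    by (rule prod; use y in \<open>simp add: field_simps\<close>)+
qed

text \<open>
  A basis of \<open>W\<close> extended to the whole space, expressed by coordinates: \<open>v\<close> lies in \<open>W\<close> iff its new
  coordinates outside \<open>S\<close> vanish. Among the coordinate systems in which the vectors supported on \<open>S\<close>
  lie in \<open>W\<close>, one with \<open>S\<close> as large as possible is chosen. If some \<open>w \<in> W\<close> had a nonzero coordinate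
  \<open>l \<notin> S\<close>, then \<open>w\<close> could replace the \<open>l\<close>-th basis vector and \<open>l\<close> could be added to \<open>S\<close>.
\<close>

lemma subspace_adapted_coordinates:
  fixes W :: "'a::field vec set"
  assumes W: "VectorSpace.subspace class_ring W (module_vec TYPE('a) n)"
  obtains S P Q where "S \<subseteq> {..<n}" "P \<in> carrier_mat n n" "Q \<in> carrier_mat n n"
    "P * Q = 1\<^sub>m n" "Q * P = 1\<^sub>m n"
    "\<And>v. v \<in> carrier_vec n \<Longrightarrow> v \<in> W \<longleftrightarrow> (\<forall>i<n. i \<notin> S \<longrightarrow> (Q *\<^sub>v v) $ i = 0)"
proof -
  note Ws = W[unfolded subspace_vec_iff]
  define good where "good S P Q \<longleftrightarrow> S \<subseteq> {..<n} \<and> P \<in> carrier_mat n n \<and> Q \<in> carrier_mat n n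
    \<and> P * Q = 1\<^sub>m n \<and> Q * P = 1\<^sub>m n \<and>
    (\<forall>v\<in>carrier_vec n. (\<forall>i<n. i \<notin> S \<longrightarrow> (Q *\<^sub>v v) $ i = 0) \<longrightarrow> v \<in> W)" for S :: "nat set" and P Q :: "'a mat"
  have "good {} (1\<^sub>m n) (1\<^sub>m n)"
  proof -
    have "v \<in> W" if "v \<in> carrier_vec n" "\<forall>i<n. (1\<^sub>m n *\<^sub>v v) $ i = 0" for v
    proof -
      have "v = 0\<^sub>v n" using that by (intro eq_vecI) auto
      then show ?thesis using Ws by simp
    qed
    then show ?thesis by (simp add: good_def)
  qed
  then have "\<exists>P Q. good {} P Q" by blast
  moreover have "\<forall>S. (\<exists>P Q. good S P Q) \<longrightarrow> card S < Suc n"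
  proof (intro allI impI)
    fix S assume "\<exists>P Q. good S P Q"
    then have "S \<subseteq> {..<n}" unfolding good_def by blast
    then have "card S \<le> card {..<n}" by (intro card_mono) auto
    then show "card S < Suc n" by simp
  qed
  ultimately obtain S where ex: "\<exists>P Q. good S P Q"
    and maxS: "\<forall>S'. (\<exists>P Q. good S' P Q) \<longrightarrow> card S' \<le> card S"
    using ex_has_greatest_nat[of "\<lambda>S. \<exists>P Q. good S P Q" "{}" card "Suc n"] by (meson less_imp_le)
  then obtain P Q where g: "good S P Q" by blast
  then have S: "S \<subseteq> {..<n}" and P: "P \<in> carrier_mat n n" and Q: "Q \<in> carrier_mat n n"
    and PQ: "P * Q = 1\<^sub>m n" and QP: "Q * P = 1\<^sub>m n"
    and bwd: "\<And>v. v \<in> carrier_vec n \<Longrightarrow> (\<forall>i<n. i \<notin> S \<longrightarrow> (Q *\<^sub>v v) $ i = 0) \<Longrightarrow> v \<in> W"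
    unfolding good_def by auto
  have fwd: "(Q *\<^sub>v w) $ l = 0" if w: "w \<in> W" and l: "l < n" "l \<notin> S" for w l
  proof (rule ccontr)
    define u where "u = Q *\<^sub>v w"
    assume "(Q *\<^sub>v w) $ l \<noteq> 0"
    then have ul: "u $ l \<noteq> 0" by (simp add: u_def)
    have wc: "w \<in> carrier_vec n" using w Ws by auto
    have uc: "u \<in> carrier_vec n" using Q wc by (simp add: u_def)
    \<comment> \<open>\<open>E y\<close> maps the \<open>l\<close>-th unit vector to \<open>u\<close>, the coordinate vector of \<open>w\<close>, and fixes the others\<close>
    define y where "y i = u $ i - (if i = l then 1 else 0)" for i
    define E where "E z = mat n n (\<lambda>(i, j). (if i = j then 1 else 0) + (if j = l then z i else 0))" for z :: "nat \<Rightarrow> 'a"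
    define x where "x i = - y i / (1 + y l)" for i
    have E: "E z \<in> carrier_mat n n" for z by (simp add: E_def)
    have yl: "1 + y l = u $ l" by (simp add: y_def)
    have inv: "E x * E y = 1\<^sub>m n" "E y * E x = 1\<^sub>m n"
      using elementary_column_inverse[OF l(1), of y] ul unfolding E_def x_def yl by auto
    have c1: "(P * E y) * (E x * Q) = 1\<^sub>m n"
    proof -
      have "(P * E y) * (E x * Q) = P * ((E y * E x) * Q)"
        using P Q E[of x] E[of y] mult_carrier_mat[OF E[of x] Q]
        by (simp add: assoc_mult_mat[of _ n n _ n _ n])
      then show ?thesis using inv PQ Q by simp
    qed
    have c2: "(E x * Q) * (P * E y) = 1\<^sub>m n"
    proof -
      have "(E x * Q) * (P * E y) = E x * ((Q * P) * E y)"
        using P Q E[of x] E[of y] mult_carrier_mat[OF P E[of y]]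
        by (simp add: assoc_mult_mat[of _ n n _ n _ n])
      then show ?thesis using inv QP E[of y] by simp
    qed
    have "v \<in> W" if v: "v \<in> carrier_vec n"
      and z: "\<forall>i<n. i \<notin> insert l S \<longrightarrow> ((E x * Q) *\<^sub>v v) $ i = 0" for v
    proof -
      \<comment> \<open>subtracting the right multiple of \<open>w\<close> reduces to a vector supported on the old \<open>S\<close>\<close>
      define c where "c = (Q *\<^sub>v v) $ l / u $ l"
      have Qv: "Q *\<^sub>v v \<in> carrier_vec n" using Q v by auto
      define v' where "v' = v - c \<cdot>\<^sub>v w"
      have v': "v' \<in> carrier_vec n" using v wc by (simp add: v'_def)
      have "(Q *\<^sub>v v') $ i = 0" if i: "i < n" "i \<notin> S" for i
      proof -
        have "Q *\<^sub>v v' = Q *\<^sub>v v - c \<cdot>\<^sub>v u"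
          unfolding v'_def u_def using Q v wc
          by (simp add: mult_minus_distrib_mat_vec[of _ n n] mult_mat_vec[of _ n n])
        then have e: "(Q *\<^sub>v v') $ i = (Q *\<^sub>v v) $ i - c * u $ i"
          using i uc Q by simp
        show ?thesis
        proof (cases "i = l")
          case True
          then show ?thesis using e ul by (simp add: c_def)
        next
          case False
          have "((E x * Q) *\<^sub>v v) $ i = (E x *\<^sub>v (Q *\<^sub>v v)) $ i"
            using E Q v by (simp add: assoc_mult_mat_vec[of _ n n _ n])
          also have "\<dots> = (\<Sum>h<n. E x $$ (i, h) * (Q *\<^sub>v v) $ h)"
            by (rule mult_mat_vec_index_sum[OF E Qv i(1)])
          also have "\<dots> = (\<Sum>h<n. (if i = h then (Q *\<^sub>v v) $ h else 0) + (if h = l then x i * (Q *\<^sub>v v) $ h else 0))"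
            by (rule sum.cong) (use i in \<open>auto simp: E_def algebra_simps\<close>)
          also have "\<dots> = (Q *\<^sub>v v) $ i + x i * (Q *\<^sub>v v) $ l"
            using i l by (simp add: sum.distrib)
          also have "x i * (Q *\<^sub>v v) $ l = - (c * u $ i)"
            using False ul unfolding x_def yl by (simp add: y_def c_def)
          finally show ?thesis using e z i False by simp
        qed
      qed
      then have "v' \<in> W" using bwd v' by blast
      moreover have "v = v' + c \<cdot>\<^sub>v w" using v wc by (intro eq_vecI) (auto simp: v'_def)
      ultimately show ?thesis using Ws w by metis
    qed
    then have "good (insert l S) (P * E y) (E x * Q)"
      unfolding good_def using S l c1 c2 mult_carrier_mat[OF P E[of y]] mult_carrier_mat[OF E[of x] Q]
      by auto
    then have "card (insert l S) \<le> card S" using maxS by blast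
    moreover have "finite S" using S finite_subset by blast
    ultimately show False using l by simp
  qed
  show thesis
    by (rule that[OF S P Q PQ QP]) (use bwd fwd in blast)
qed

section \<open>Representations and Schur's lemma\<close>

lemma (in group) representation_iff:
  "representation G n \<rho> \<longleftrightarrow>
     (\<forall>g\<in>carrier G. \<rho> g \<in> carrier_mat n n) \<and>
     (\<forall>g\<in>carrier G. \<forall>h\<in>carrier G. \<rho> (g \<otimes> h) = \<rho> g * \<rho> h) \<and> \<rho> \<one> = 1\<^sub>m n"
  (is "_ \<longleftrightarrow> ?R")
proof
  assume rep: "representation G n \<rho>"
  then have U: "\<rho> g \<in> Units (ring_mat TYPE(complex) n ())" if "g \<in> carrier G" for g
    using that unfolding representation_def hom_def by (auto simp: units_of_carrier)
  have mul: "\<rho> (g \<otimes> h) = \<rho> g * \<rho> h" if "g \<in> carrier G" "h \<in> carrier G" for g h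
    using rep that unfolding representation_def hom_def by (simp add: units_of_mult ring_mat_simps)
  have C: "\<rho> g \<in> carrier_mat n n" if "g \<in> carrier G" for g
    using U[OF that] by (simp add: Units_def ring_mat_simps)
  obtain B where B: "B \<in> carrier_mat n n" "B * \<rho> \<one> = 1\<^sub>m n"
    using U[of \<one>] by (auto simp: Units_def ring_mat_simps)
  have "\<rho> \<one> = (B * \<rho> \<one>) * \<rho> \<one>" using B C[of \<one>] by simp
  also have "\<dots> = B * (\<rho> \<one> * \<rho> \<one>)" by (rule assoc_mult_mat[OF B(1) C C]) auto
  also have "\<rho> \<one> * \<rho> \<one> = \<rho> \<one>" using mul[of \<one> \<one>] by simp
  finally show ?R using B C mul by auto
next
  assume R: ?R
  have "\<rho> g \<in> Units (ring_mat TYPE(complex) n ())" if g: "g \<in> carrier G" for g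
  proof -
    have "\<rho> (inv g) * \<rho> g = 1\<^sub>m n" "\<rho> g * \<rho> (inv g) = 1\<^sub>m n"
      using R g by (metis inv_closed l_inv r_inv)+
    then show ?thesis using R g by (auto simp: Units_def ring_mat_simps)
  qed
  then show "representation G n \<rho>"
    using R unfolding representation_def hom_def by (auto simp: units_of_carrier units_of_mult ring_mat_simps)
qed

lemma (in group) character_of_eq_mat_trace:
  assumes "representation G n \<rho>" "g \<in> carrier G"
  shows "character_of G n \<rho> g = mat_trace (\<rho> g)"
  using assms by (auto simp: character_of_def mat_trace_def representation_iff)

lemma (in group) irreducible_representationD:
  assumes irr: "irreducible_representation G n \<rho>"
  shows "representation G n \<rho>" "n > 0"
    and "\<And>W. W \<subseteq> carrier_vec n \<Longrightarrow> 0\<^sub>v n \<in> W \<Longrightarrow> (\<And>v w. v \<in> W \<Longrightarrow> w \<in> W \<Longrightarrow> v + w \<in> W) \<Longrightarrow>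
       (\<And>c v. v \<in> W \<Longrightarrow> c \<cdot>\<^sub>v v \<in> W) \<Longrightarrow>
       (\<And>g w. g \<in> carrier G \<Longrightarrow> w \<in> W \<Longrightarrow> \<rho> g *\<^sub>v w \<in> W) \<Longrightarrow> W = {0\<^sub>v n} \<or> W = carrier_vec n"
proof -
  show "representation G n \<rho>" "n > 0" using irr by (simp_all add: irreducible_representation_def)
  fix W :: "complex vec set"
  assume *: "W \<subseteq> carrier_vec n" "0\<^sub>v n \<in> W" "\<And>v w. v \<in> W \<Longrightarrow> w \<in> W \<Longrightarrow> v + w \<in> W"
    "\<And>c v. v \<in> W \<Longrightarrow> c \<cdot>\<^sub>v v \<in> W" "\<And>g w. g \<in> carrier G \<Longrightarrow> w \<in> W \<Longrightarrow> \<rho> g *\<^sub>v w \<in> W"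
  have "VectorSpace.subspace class_ring W (module_vec TYPE(complex) n)"
    unfolding subspace_vec_iff using *(1-4) by simp
  then show "W = {0\<^sub>v n} \<or> W = carrier_vec n"
    using irr *(5) unfolding irreducible_representation_def by simp
qed

lemma (in group) intertwiner_kernel_trivial_or_everything:
  assumes irr: "irreducible_representation G n \<rho>"
    and \<sigma>: "representation G m \<sigma>"
    and T: "T \<in> carrier_mat m n"
    and twine: "\<And>g. g \<in> carrier G \<Longrightarrow> \<sigma> g * T = T * \<rho> g"
  shows "T = 0\<^sub>m m n \<or> (\<forall>v\<in>carrier_vec n. T *\<^sub>v v = 0\<^sub>v m \<longrightarrow> v = 0\<^sub>v n)"
proof -
  define K where "K = {v \<in> carrier_vec n. T *\<^sub>v v = 0\<^sub>v m}"
  note \<rho> = irreducible_representationD(1)[OF irr, unfolded representation_iff]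
  note \<sigma> = \<sigma>[unfolded representation_iff]
  have "K = {0\<^sub>v n} \<or> K = carrier_vec n"
  proof (rule irreducible_representationD(3)[OF irr])
    fix g w assume g: "g \<in> carrier G" and w: "w \<in> K"
    have c: "\<rho> g \<in> carrier_mat n n" "\<sigma> g \<in> carrier_mat m m" "w \<in> carrier_vec n"
      using \<rho> \<sigma> g w by (auto simp: K_def)
    have "T *\<^sub>v (\<rho> g *\<^sub>v w) = \<sigma> g *\<^sub>v (T *\<^sub>v w)"
      using assoc_mult_mat_vec[OF T c(1,3)] assoc_mult_mat_vec[OF c(2) T c(3)] twine[OF g] by simp
    also have "\<dots> = 0\<^sub>v m" using w c by (auto simp: K_def)
    finally show "\<rho> g *\<^sub>v w \<in> K" using c by (auto simp: K_def)
  qed (use T in \<open>auto simp: K_def mult_add_distrib_mat_vec[of _ m n] mult_mat_vec[of _ m n]\<close>)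
  then show ?thesis
  proof
    assume "K = carrier_vec n"
    then have "T = 0\<^sub>m m n"
      by (intro mat_eq_0_if_kills_all[OF T]) (auto simp: K_def)
    then show ?thesis ..
  qed (auto simp: K_def)
qed

text \<open>
  The kernel of an intertwiner is an invariant subspace of its source, the image one of its target;
  if the intertwiner is not zero, irreducibility leaves only a trivial kernel and a full image.
\<close>

lemma (in group) schur_lemma:
  assumes irr\<rho>: "irreducible_representation G n \<rho>"
    and irr\<sigma>: "irreducible_representation G m \<sigma>"
    and T: "T \<in> carrier_mat m n"
    and twine: "\<And>g. g \<in> carrier G \<Longrightarrow> \<sigma> g * T = T * \<rho> g"
    and ne: "T \<noteq> 0\<^sub>m m n"
  obtains S where "S \<in> carrier_mat n m" "S * T = 1\<^sub>m n" "T * S = 1\<^sub>m m"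
proof -
  note \<rho> = irreducible_representationD(1)[OF irr\<rho>, unfolded representation_iff]
  note \<sigma> = irreducible_representationD(1)[OF irr\<sigma>, unfolded representation_iff]
  have inj: "\<And>v. v \<in> carrier_vec n \<Longrightarrow> T *\<^sub>v v = 0\<^sub>v m \<Longrightarrow> v = 0\<^sub>v n"
    using intertwiner_kernel_trivial_or_everything[OF irr\<rho> irreducible_representationD(1)[OF irr\<sigma>] T twine] ne
    by blast
  define I where "I = (\<lambda>v. T *\<^sub>v v) ` carrier_vec n"
  have "I = {0\<^sub>v m} \<or> I = carrier_vec m"
  proof (rule irreducible_representationD(3)[OF irr\<sigma>])
    fix g w assume g: "g \<in> carrier G" and "w \<in> I"
    then obtain v where v: "v \<in> carrier_vec n" "w = T *\<^sub>v v" by (auto simp: I_def)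
    have c: "\<rho> g \<in> carrier_mat n n" "\<sigma> g \<in> carrier_mat m m"
      using \<rho> \<sigma> g by auto
    have "\<sigma> g *\<^sub>v w = T *\<^sub>v (\<rho> g *\<^sub>v v)"
      using assoc_mult_mat_vec[OF T c(1) v(1)] assoc_mult_mat_vec[OF c(2) T v(1)] twine[OF g] v by simp
    then show "\<sigma> g *\<^sub>v w \<in> I" using c v by (auto simp: I_def)
  next
    show "0\<^sub>v m \<in> I" unfolding I_def by (rule image_eqI[of _ _ "0\<^sub>v n"]) (use T in auto)
  next
    fix v w assume "v \<in> I" "w \<in> I"
    then obtain v' w' where vw: "v' \<in> carrier_vec n" "w' \<in> carrier_vec n" "v = T *\<^sub>v v'" "w = T *\<^sub>v w'"
      by (auto simp: I_def)
    then show "v + w \<in> I" unfolding I_def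
      by (intro image_eqI[of _ _ "v' + w'"]) (auto simp: mult_add_distrib_mat_vec[OF T])
  next
    fix c v assume "v \<in> I"
    then obtain v' where v: "v' \<in> carrier_vec n" "v = T *\<^sub>v v'" by (auto simp: I_def)
    then show "c \<cdot>\<^sub>v v \<in> I" unfolding I_def
      by (intro image_eqI[of _ _ "c \<cdot>\<^sub>v v'"]) (auto simp: mult_mat_vec[OF T])
  qed (use T in \<open>auto simp: I_def\<close>)
  moreover have "I \<noteq> {0\<^sub>v m}"
  proof
    assume "I = {0\<^sub>v m}"
    then have "T = 0\<^sub>m m n"
      by (intro mat_eq_0_if_kills_all[OF T]) (auto simp: I_def)
    with ne show False ..
  qed
  ultimately have "I = carrier_vec m" by blast
  then have "\<exists>v\<in>carrier_vec n. T *\<^sub>v v = w" if "w \<in> carrier_vec m" for w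
    using that unfolding I_def by (metis imageE)
  then show thesis
    using mat_inverse_if_bijective[OF T inj] that by blast
qed

lemma (in group) intertwiner_eq_0_if_characters_differ:
  assumes irr\<rho>: "irreducible_representation G n \<rho>"
    and irr\<sigma>: "irreducible_representation G m \<sigma>"
    and T: "T \<in> carrier_mat m n"
    and twine: "\<And>g. g \<in> carrier G \<Longrightarrow> \<sigma> g * T = T * \<rho> g"
    and ne: "character_of G m \<sigma> \<noteq> character_of G n \<rho>"
  shows "T = 0\<^sub>m m n"
proof (rule ccontr)
  assume "T \<noteq> 0\<^sub>m m n"
  then obtain S where S: "S \<in> carrier_mat n m" "S * T = 1\<^sub>m n" "T * S = 1\<^sub>m m"
    using schur_lemma[OF irr\<rho> irr\<sigma> T twine] by blast
  note reps = irreducible_representationD(1)[OF irr\<rho>] irreducible_representationD(1)[OF irr\<sigma>]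
  have "character_of G m \<sigma> g = character_of G n \<rho> g" for g
  proof (cases "g \<in> carrier G")
    case g: True
    have c: "\<rho> g \<in> carrier_mat n n" "\<sigma> g \<in> carrier_mat m m" using reps g by (auto simp: representation_iff)
    have "\<sigma> g = \<sigma> g * (T * S)" using S c by simp
    also have "\<dots> = T * \<rho> g * S"
      using assoc_mult_mat[OF c(2) T S(1)] twine[OF g] by simp
    finally have "mat_trace (\<sigma> g) = mat_trace (\<rho> g)"
      using mat_trace_conjugate[OF c(1) T S(1,2)] by simp
    then show ?thesis using reps g by (simp add: character_of_eq_mat_trace)
  qed (simp add: character_of_def)
  then show False using ne by blast
qed

text \<open>
  Over the complex numbers \<open>T\<close> has an eigenvalue \<open>c\<close>, and \<open>T - c 1\<close> is an intertwiner with a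
  nontrivial kernel, hence zero.
\<close>

lemma (in group) self_intertwiner_scalar:
  assumes irr: "irreducible_representation G n \<rho>"
    and T: "T \<in> carrier_mat n n"
    and twine: "\<And>g. g \<in> carrier G \<Longrightarrow> \<rho> g * T = T * \<rho> g"
  obtains c where "T = c \<cdot>\<^sub>m 1\<^sub>m n"
proof -
  note reps = irreducible_representationD(1)[OF irr]
  obtain c where "eigenvalue T c"
    using spectrum_non_empty[OF T irreducible_representationD(2)[OF irr]] by (auto simp: spectrum_def)
  then obtain v where v: "v \<in> carrier_vec n" "v \<noteq> 0\<^sub>v n" "T *\<^sub>v v = c \<cdot>\<^sub>v v"
    using T by (auto simp: eigenvalue_def eigenvector_def)
  define U where "U = T - c \<cdot>\<^sub>m 1\<^sub>m n"
  have U: "U \<in> carrier_mat n n" using T by (auto simp: U_def)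
  have "\<rho> g * U = U * \<rho> g" if g: "g \<in> carrier G" for g
  proof -
    have c: "\<rho> g \<in> carrier_mat n n" using reps g by (auto simp: representation_iff)
    have "\<rho> g * U = \<rho> g * T - \<rho> g * (c \<cdot>\<^sub>m 1\<^sub>m n)"
      unfolding U_def by (rule mult_minus_distrib_mat[OF c T]) auto
    also have "\<rho> g * (c \<cdot>\<^sub>m 1\<^sub>m n) = (c \<cdot>\<^sub>m 1\<^sub>m n) * \<rho> g"
      using c mult_smult_distrib[OF c one_carrier_mat] mult_smult_assoc_mat[OF one_carrier_mat c]
      by simp
    also have "\<rho> g * T - (c \<cdot>\<^sub>m 1\<^sub>m n) * \<rho> g = U * \<rho> g"
      unfolding U_def twine[OF g] by (rule minus_mult_distrib_mat[symmetric, OF T _ c]) auto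
    finally show ?thesis .
  qed
  moreover have "U *\<^sub>v v = 0\<^sub>v n"
  proof -
    have "U *\<^sub>v v = T *\<^sub>v v - (c \<cdot>\<^sub>m 1\<^sub>m n) *\<^sub>v v"
      unfolding U_def by (rule minus_mult_distrib_mat_vec[OF T _ v(1)]) auto
    also have "(c \<cdot>\<^sub>m 1\<^sub>m n) *\<^sub>v v = c \<cdot>\<^sub>v v"
      using v(1) by (intro eq_vecI) auto
    finally show ?thesis using v by auto
  qed
  ultimately have U0: "U = 0\<^sub>m n n"
    using intertwiner_kernel_trivial_or_everything[OF irr reps U] v by blast
  have "T = c \<cdot>\<^sub>m 1\<^sub>m n"
  proof (rule eq_matI)
    fix i j assume ij: "i < dim_row (c \<cdot>\<^sub>m 1\<^sub>m n :: complex mat)" "j < dim_col (c \<cdot>\<^sub>m 1\<^sub>m n :: complex mat)"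
    have "U $$ (i, j) = 0" using U0 ij by simp
    then show "T $$ (i, j) = (c \<cdot>\<^sub>m 1\<^sub>m n) $$ (i, j)" using ij T by (simp add: U_def)
  qed (use T in auto)
  then show thesis using that by blast
qed

section \<open>Orthogonality of irreducible characters\<close>

lemma (in group) sum_translate:
  assumes "h \<in> carrier G"
  shows "(\<Sum>g\<in>carrier G. f (h \<otimes> g)) = (\<Sum>g\<in>carrier G. f g)"
  by (rule sum.reindex_bij_witness[of _ "\<lambda>g. inv h \<otimes> g" "\<lambda>g. h \<otimes> g"])
     (use assms in \<open>auto simp: m_assoc[symmetric]\<close>)

text \<open>
  The group sum \<open>\<Sum>g. \<sigma>(g) E \<rho>(g)\<^sup>-\<^sup>1\<close> for the matrix unit \<open>E\<close> with its single 1 in row \<open>b\<close> and column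
  \<open>c\<close>, written out in entries. Schur's lemma applied to it yields the orthogonality of matrix
  coefficients.
\<close>

definition averaged_intertwiner ::
    "('g, 'm) monoid_scheme \<Rightarrow> nat \<Rightarrow> ('g \<Rightarrow> complex mat) \<Rightarrow> nat \<Rightarrow> ('g \<Rightarrow> complex mat) \<Rightarrow> nat \<Rightarrow> nat \<Rightarrow> complex mat" where
  "averaged_intertwiner G m \<sigma> n \<rho> b c =
     mat m n (\<lambda>(i, l). \<Sum>g\<in>carrier G. \<sigma> g $$ (i, b) * \<rho> (inv\<^bsub>G\<^esub> g) $$ (c, l))"

lemma averaged_intertwiner_carrier [simp]:
  "averaged_intertwiner G m \<sigma> n \<rho> b c \<in> carrier_mat m n"
  by (simp add: averaged_intertwiner_def)

text \<open>
  Multiplication by \<open>h\<close> only permutes the summands: replacing \<open>g\<close> by \<open>h g\<close> turns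
  \<open>\<sigma>(g) E \<rho>(g\<^sup>-\<^sup>1 h)\<close> into \<open>\<sigma>(h g) E \<rho>(g\<^sup>-\<^sup>1)\<close>.
\<close>

lemma (in group) averaged_intertwiner_twines:
  assumes \<rho>: "representation G n \<rho>" and \<sigma>: "representation G m \<sigma>"
    and b: "b < m" and c: "c < n" and h: "h \<in> carrier G"
  shows "\<sigma> h * averaged_intertwiner G m \<sigma> n \<rho> b c = averaged_intertwiner G m \<sigma> n \<rho> b c * \<rho> h"
    (is "_ * ?T = _")
proof (rule eq_matI)
  note R = \<rho>[unfolded representation_iff] \<sigma>[unfolded representation_iff]
  have T: "?T \<in> carrier_mat m n" by simp
  fix i l assume "i < dim_row (?T * \<rho> h)" "l < dim_col (?T * \<rho> h)"
  then have il: "i < m" "l < n" using R h T by auto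
  have Rh: "\<sigma> h \<in> carrier_mat m m" "\<rho> h \<in> carrier_mat n n" using R h by auto
  have "(\<sigma> h * ?T) $$ (i, l) = (\<Sum>p<m. \<sigma> h $$ (i, p) * ?T $$ (p, l))"
    by (rule mult_mat_index_sum[OF Rh(1) T il])
  also have "\<dots> = (\<Sum>p<m. \<Sum>g\<in>carrier G. \<sigma> h $$ (i, p) * \<sigma> g $$ (p, b) * \<rho> (inv g) $$ (c, l))"
    by (rule sum.cong) (use il in \<open>auto simp: averaged_intertwiner_def sum_distrib_left mult.assoc\<close>)
  also have "\<dots> = (\<Sum>g\<in>carrier G. \<Sum>p<m. \<sigma> h $$ (i, p) * \<sigma> g $$ (p, b) * \<rho> (inv g) $$ (c, l))"
    by (rule sum.swap)
  also have "\<dots> = (\<Sum>g\<in>carrier G. \<sigma> (h \<otimes> g) $$ (i, b) * \<rho> (inv g) $$ (c, l))"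
  proof (rule sum.cong[OF refl])
    fix g assume g: "g \<in> carrier G"
    have "\<sigma> (h \<otimes> g) $$ (i, b) = (\<sigma> h * \<sigma> g) $$ (i, b)" using R h g by simp
    also have "\<dots> = (\<Sum>p<m. \<sigma> h $$ (i, p) * \<sigma> g $$ (p, b))"
      by (rule mult_mat_index_sum[OF Rh(1)]) (use R g il b in auto)
    finally show "(\<Sum>p<m. \<sigma> h $$ (i, p) * \<sigma> g $$ (p, b) * \<rho> (inv g) $$ (c, l)) =
        \<sigma> (h \<otimes> g) $$ (i, b) * \<rho> (inv g) $$ (c, l)" by (simp add: sum_distrib_right)
  qed
  also have "\<dots> = (\<Sum>g\<in>carrier G. \<sigma> (h \<otimes> g) $$ (i, b) * \<rho> (inv (h \<otimes> g) \<otimes> h) $$ (c, l))"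
    by (rule sum.cong) (use h in \<open>auto simp: inv_mult_group m_assoc\<close>)
  also have "\<dots> = (\<Sum>g\<in>carrier G. \<sigma> g $$ (i, b) * \<rho> (inv g \<otimes> h) $$ (c, l))"
    by (rule sum_translate[OF h, of "\<lambda>g. \<sigma> g $$ (i, b) * \<rho> (inv g \<otimes> h) $$ (c, l)"])
  also have "\<dots> = (\<Sum>g\<in>carrier G. \<Sum>p<n. \<sigma> g $$ (i, b) * \<rho> (inv g) $$ (c, p) * \<rho> h $$ (p, l))"
  proof (rule sum.cong[OF refl])
    fix g assume g: "g \<in> carrier G"
    have "\<rho> (inv g \<otimes> h) $$ (c, l) = (\<rho> (inv g) * \<rho> h) $$ (c, l)" using R h g by simp
    also have "\<dots> = (\<Sum>p<n. \<rho> (inv g) $$ (c, p) * \<rho> h $$ (p, l))"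
      by (rule mult_mat_index_sum[of _ n n]) (use R g h il c in auto)
    finally show "\<sigma> g $$ (i, b) * \<rho> (inv g \<otimes> h) $$ (c, l) =
      (\<Sum>p<n. \<sigma> g $$ (i, b) * \<rho> (inv g) $$ (c, p) * \<rho> h $$ (p, l))"
      by (simp add: sum_distrib_left mult.assoc)
  qed
  also have "\<dots> = (\<Sum>p<n. \<Sum>g\<in>carrier G. \<sigma> g $$ (i, b) * \<rho> (inv g) $$ (c, p) * \<rho> h $$ (p, l))"
    by (rule sum.swap)
  also have "\<dots> = (\<Sum>p<n. ?T $$ (i, p) * \<rho> h $$ (p, l))"
    by (rule sum.cong) (use il in \<open>auto simp: averaged_intertwiner_def sum_distrib_right\<close>)
  also have "\<dots> = (?T * \<rho> h) $$ (i, l)"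
    by (rule mult_mat_index_sum[symmetric, OF T Rh(2) il])
  finally show "(\<sigma> h * ?T) $$ (i, l) = (?T * \<rho> h) $$ (i, l)" .
qed (use \<rho>[unfolded representation_iff] \<sigma>[unfolded representation_iff] h in \<open>auto simp: averaged_intertwiner_def\<close>)

lemma (in group) sum_characters_eq_sum_averaged:
  assumes "representation G n \<rho>" "representation G m \<sigma>"
  shows "(\<Sum>g\<in>carrier G. character_of G m \<sigma> g * character_of G n \<rho> (inv g)) =
    (\<Sum>i<m. \<Sum>l<n. averaged_intertwiner G m \<sigma> n \<rho> i l $$ (i, l))"
proof -
  have "(\<Sum>g\<in>carrier G. character_of G m \<sigma> g * character_of G n \<rho> (inv g)) =
    (\<Sum>g\<in>carrier G. \<Sum>i<m. \<Sum>l<n. \<sigma> g $$ (i, i) * \<rho> (inv g) $$ (l, l))"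
    by (rule sum.cong) (auto simp: character_of_def sum_product)
  also have "\<dots> = (\<Sum>i<m. \<Sum>g\<in>carrier G. \<Sum>l<n. \<sigma> g $$ (i, i) * \<rho> (inv g) $$ (l, l))"
    by (rule sum.swap)
  also have "\<dots> = (\<Sum>i<m. \<Sum>l<n. averaged_intertwiner G m \<sigma> n \<rho> i l $$ (i, l))"
    by (rule sum.cong[OF refl], subst sum.swap, rule sum.cong) (auto simp: averaged_intertwiner_def)
  finally show ?thesis .
qed

text \<open>
  For different characters all averaged intertwiners vanish. For equal ones both may be taken with
  the same representation; then \<open>averaged_intertwiner\<close> at \<open>(i, l)\<close> is a scalar matrix \<open>c 1\<close>, and its
  trace \<open>n c\<close> equals \<open>\<Sum>g. (\<rho>(g\<^sup>-\<^sup>1) \<rho>(g))\<^sub>l\<^sub>i\<close>, which is \<open>|G|\<close> or \<open>0\<close>. The value of the second character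
  at \<open>g\<^sup>-\<^sup>1\<close> is the complex conjugate of its value at \<open>g\<close>, so this is \<open>|G|\<close> times the usual scalar product.
\<close>

theorem (in group) irreducible_characters_orthonormal:
  assumes fin: "finite (carrier G)" and \<chi>: "\<chi> \<in> Irr G" and \<psi>: "\<psi> \<in> Irr G"
  shows "(\<Sum>g\<in>carrier G. \<chi> g * \<psi> (inv g)) = (if \<chi> = \<psi> then of_nat (Coset.order G) else 0)"
proof -
  obtain n \<rho> where \<rho>: "irreducible_representation G n \<rho>" "\<psi> = character_of G n \<rho>"
    using \<psi> by (auto simp: Irr_def)
  obtain m \<sigma> where \<sigma>: "irreducible_representation G m \<sigma>" "\<chi> = character_of G m \<sigma>"
    using \<chi> by (auto simp: Irr_def)
  note rep\<rho> = irreducible_representationD(1)[OF \<rho>(1)]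
  note rep\<sigma> = irreducible_representationD(1)[OF \<sigma>(1)]
  show ?thesis
  proof (cases "\<chi> = \<psi>")
    case False
    have "averaged_intertwiner G m \<sigma> n \<rho> i l = 0\<^sub>m m n" if "i < m" "l < n" for i l
      by (rule intertwiner_eq_0_if_characters_differ[OF \<rho>(1) \<sigma>(1)])
         (use that False \<rho>(2) \<sigma>(2) in \<open>auto simp: averaged_intertwiner_twines[OF rep\<rho> rep\<sigma>]\<close>)
    then show ?thesis
      unfolding \<sigma>(2) \<rho>(2) sum_characters_eq_sum_averaged[OF rep\<rho> rep\<sigma>]
      using False \<rho>(2) \<sigma>(2) by simp
  next
    case True
    let ?T = "averaged_intertwiner G n \<rho> n \<rho>"
    have n: "n > 0" by (rule irreducible_representationD(2)[OF \<rho>(1)])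
    note R = rep\<rho>[unfolded representation_iff]
    have entry: "?T i l $$ (i, l) = (if i = l then of_nat (Coset.order G) / of_nat n else 0)"
      if il: "i < n" "l < n" for i l
    proof -
      have Tc: "?T i l \<in> carrier_mat n n" by simp
      obtain c where c: "?T i l = c \<cdot>\<^sub>m 1\<^sub>m n"
        using self_intertwiner_scalar[OF \<rho>(1) Tc] averaged_intertwiner_twines[OF rep\<rho> rep\<rho> il] by blast
      have "of_nat n * c = (\<Sum>p<n. ?T i l $$ (p, p))" unfolding c by simp
      also have "\<dots> = (\<Sum>p<n. \<Sum>g\<in>carrier G. \<rho> (inv g) $$ (l, p) * \<rho> g $$ (p, i))"
        by (rule sum.cong) (auto simp: averaged_intertwiner_def mult.commute)
      also have "\<dots> = (\<Sum>g\<in>carrier G. \<Sum>p<n. \<rho> (inv g) $$ (l, p) * \<rho> g $$ (p, i))"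
        by (rule sum.swap)
      also have "\<dots> = (\<Sum>g\<in>carrier G. (1\<^sub>m n :: complex mat) $$ (l, i))"
      proof (rule sum.cong[OF refl])
        fix g assume g: "g \<in> carrier G"
        have "(\<Sum>p<n. \<rho> (inv g) $$ (l, p) * \<rho> g $$ (p, i)) = (\<rho> (inv g) * \<rho> g) $$ (l, i)"
          by (rule mult_mat_index_sum[symmetric, of _ n n]) (use R g il in auto)
        also have "\<rho> (inv g) * \<rho> g = 1\<^sub>m n" using R g by (metis inv_closed l_inv)
        finally show "(\<Sum>p<n. \<rho> (inv g) $$ (l, p) * \<rho> g $$ (p, i)) = 1\<^sub>m n $$ (l, i)" .
      qed
      also have "\<dots> = (if i = l then of_nat (Coset.order G) else 0)"
        using il by (simp add: Coset.order_def)
      finally have "c = (if i = l then of_nat (Coset.order G) / of_nat n else 0)"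
        using n by (auto simp: field_simps split: if_splits)
      then show ?thesis using il unfolding c by auto
    qed
    have "(\<Sum>g\<in>carrier G. \<chi> g * \<psi> (inv g)) = (\<Sum>i<n. \<Sum>l<n. ?T i l $$ (i, l))"
      unfolding True unfolding \<rho>(2) by (rule sum_characters_eq_sum_averaged[OF rep\<rho> rep\<rho>])
    also have "\<dots> = (\<Sum>i<n. \<Sum>l<n. if i = l then of_nat (Coset.order G) / of_nat n else 0)"
      by (intro sum.cong refl) (use entry in auto)
    also have "\<dots> = of_nat (Coset.order G)" using n by simp
    finally show ?thesis using True by simp
  qed
qed

section \<open>Decomposition of characters\<close>

lemma (in group) representation_conjugate:
  assumes \<rho>: "representation G n \<rho>"
    and P: "P \<in> carrier_mat n n" and Q: "Q \<in> carrier_mat n n"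
    and PQ: "P * Q = 1\<^sub>m n" and QP: "Q * P = 1\<^sub>m n"
  shows "representation G n (\<lambda>g. Q * \<rho> g * P)"
    and "character_of G n (\<lambda>g. Q * \<rho> g * P) = character_of G n \<rho>"
proof -
  note R = \<rho>[unfolded representation_iff]
  have mul: "Q * \<rho> (g \<otimes> h) * P = Q * \<rho> g * P * (Q * \<rho> h * P)"
    if g: "g \<in> carrier G" and h: "h \<in> carrier G" for g h
  proof -
    have c: "\<rho> g \<in> carrier_mat n n" "\<rho> h \<in> carrier_mat n n" using R g h by auto
    have c': "Q * \<rho> g \<in> carrier_mat n n" "\<rho> h * P \<in> carrier_mat n n" "Q * \<rho> h \<in> carrier_mat n n"
      using c P Q by auto
    have "Q * \<rho> g * P * (Q * \<rho> h * P) = Q * \<rho> g * (P * (Q * (\<rho> h * P)))"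
      using P Q c c' by (simp add: assoc_mult_mat[of _ n n _ n _ n])
    also have "P * (Q * (\<rho> h * P)) = \<rho> h * P"
      using assoc_mult_mat[OF P Q c'(2)] left_mult_one_mat[OF c'(2)] PQ by simp
    also have "Q * \<rho> g * (\<rho> h * P) = Q * \<rho> (g \<otimes> h) * P"
      using P Q R g h c c' mult_carrier_mat[OF c] by (simp add: assoc_mult_mat[of _ n n _ n _ n])
    finally show ?thesis ..
  qed
  show rep: "representation G n (\<lambda>g. Q * \<rho> g * P)"
    unfolding representation_iff using R P Q QP mul by auto
  show "character_of G n (\<lambda>g. Q * \<rho> g * P) = character_of G n \<rho>"
  proof
    fix g
    show "character_of G n (\<lambda>g. Q * \<rho> g * P) g = character_of G n \<rho> g"
    proof (cases "g \<in> carrier G")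
      case True
      then show ?thesis
        using character_of_eq_mat_trace[OF rep] character_of_eq_mat_trace[OF \<rho>]
          mat_trace_conjugate[of "\<rho> g" n Q n P] R P Q PQ by simp
    qed (simp add: character_of_def)
  qed
qed

text \<open>
  The hypothesis says that matrix products restricted to the rows and columns in \<open>A\<close> only see the
  indices in \<open>A\<close>. It holds for both diagonal blocks of a block triangular representation: for one
  block because the second factor vanishes, for the other because the first one does.
\<close>

lemma (in group) block_representation:
  assumes \<rho>: "representation G n \<rho>" and A: "A \<subseteq> {..<n}"
    and block: "\<And>g h i j l. g \<in> carrier G \<Longrightarrow> h \<in> carrier G \<Longrightarrow> i \<in> A \<Longrightarrow> j \<in> A \<Longrightarrow> l < n \<Longrightarrow> l \<notin> A
      \<Longrightarrow> \<rho> g $$ (i, l) * \<rho> h $$ (l, j) = 0"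
  obtains \<sigma> where "representation G (card A) \<sigma>"
    "\<And>g. g \<in> carrier G \<Longrightarrow> character_of G (card A) \<sigma> g = (\<Sum>i\<in>A. \<rho> g $$ (i, i))"
proof -
  note R = \<rho>[unfolded representation_iff]
  let ?m = "card A"
  have "finite A" using A finite_subset by blast
  then obtain f where f: "bij_betw f {..<?m} A"
    using ex_bij_betw_nat_finite[of A] by (auto simp: lessThan_atLeast0)
  have fA: "f i \<in> A" "f i < n" if "i < ?m" for i
    using f A that by (auto simp: bij_betw_def)
  have finj: "f i = f j \<longleftrightarrow> i = j" if "i < ?m" "j < ?m" for i j
    using f that by (auto simp: bij_betw_def inj_on_def)
  define \<sigma> where "\<sigma> g = mat ?m ?m (\<lambda>(i, j). \<rho> g $$ (f i, f j))" for g
  have \<sigma>c: "\<sigma> g \<in> carrier_mat ?m ?m" for g by (simp add: \<sigma>_def)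
  have "representation G ?m \<sigma>"
    unfolding representation_iff
  proof (intro conjI ballI)
    show "\<sigma> g \<in> carrier_mat ?m ?m" for g by (rule \<sigma>c)
    show "\<sigma> \<one> = 1\<^sub>m ?m"
      using R by (intro eq_matI) (auto simp: \<sigma>_def fA finj)
    fix g h assume g: "g \<in> carrier G" and h: "h \<in> carrier G"
    show "\<sigma> (g \<otimes> h) = \<sigma> g * \<sigma> h"
    proof (rule eq_matI)
      fix i j assume "i < dim_row (\<sigma> g * \<sigma> h)" "j < dim_col (\<sigma> g * \<sigma> h)"
      then have ij: "i < ?m" "j < ?m" by (auto simp: \<sigma>_def)
      have "\<sigma> (g \<otimes> h) $$ (i, j) = (\<rho> g * \<rho> h) $$ (f i, f j)"
        using ij R g h by (simp add: \<sigma>_def)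
      also have "\<dots> = (\<Sum>l<n. \<rho> g $$ (f i, l) * \<rho> h $$ (l, f j))"
        by (rule mult_mat_index_sum[of _ n n _ n]) (use R g h fA ij in auto)
      also have "\<dots> = (\<Sum>l\<in>A. \<rho> g $$ (f i, l) * \<rho> h $$ (l, f j))"
        by (rule sum.mono_neutral_right) (use A block[OF g h] fA ij in auto)
      also have "\<dots> = (\<Sum>p<?m. \<rho> g $$ (f i, f p) * \<rho> h $$ (f p, f j))"
        by (rule sum.reindex_bij_betw[OF f, symmetric])
      also have "\<dots> = (\<Sum>p<?m. \<sigma> g $$ (i, p) * \<sigma> h $$ (p, j))"
        by (rule sum.cong) (use ij in \<open>auto simp: \<sigma>_def\<close>)
      also have "\<dots> = (\<sigma> g * \<sigma> h) $$ (i, j)"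
        by (rule mult_mat_index_sum[OF \<sigma>c \<sigma>c ij, symmetric])
      finally show "\<sigma> (g \<otimes> h) $$ (i, j) = (\<sigma> g * \<sigma> h) $$ (i, j)" .
    qed (auto simp: \<sigma>_def)
  qed
  moreover have "character_of G ?m \<sigma> g = (\<Sum>i\<in>A. \<rho> g $$ (i, i))" if "g \<in> carrier G" for g
    using that by (simp add: character_of_def \<sigma>_def sum.reindex_bij_betw[OF f, of "\<lambda>i. \<rho> g $$ (i, i)"])
  ultimately show thesis by (rule that)
qed

text \<open>
  An invariant subspace makes the representation block triangular in adapted coordinates, so the
  character is the sum of the characters of the two diagonal blocks, which have smaller degree.
\<close>

theorem (in group) character_sum_of_irreducibles:
  assumes "representation G n \<rho>"
  shows "\<exists>\<chi>s. set \<chi>s \<subseteq> Irr G \<and> (\<forall>g\<in>carrier G. character_of G n \<rho> g = (\<Sum>\<chi>\<leftarrow>\<chi>s. \<chi> g))"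
  using assms
proof (induction n arbitrary: \<rho> rule: less_induct)
  case (less n)
  note R = less.prems[unfolded representation_iff]
  consider "n = 0" | "irreducible_representation G n \<rho>"
    | W where "VectorSpace.subspace class_ring W (module_vec TYPE(complex) n)"
        "\<And>g w. g \<in> carrier G \<Longrightarrow> w \<in> W \<Longrightarrow> \<rho> g *\<^sub>v w \<in> W" "W \<noteq> {0\<^sub>v n}" "W \<noteq> carrier_vec n"
    using less.prems unfolding irreducible_representation_def by (cases "n = 0") (simp, blast)
  then show ?case
  proof cases
    case 1
    then show ?thesis by (intro exI[of _ "[]"]) (simp add: character_of_def)
  next
    case 2
    then show ?thesis by (intro exI[of _ "[character_of G n \<rho>]"]) (auto simp: Irr_def)
  next
    case (3 W)
    obtain S P Q where S: "S \<subseteq> {..<n}" and P: "P \<in> carrier_mat n n" and Q: "Q \<in> carrier_mat n n"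
      and PQ: "P * Q = 1\<^sub>m n" and QP: "Q * P = 1\<^sub>m n"
      and W: "\<And>v. v \<in> carrier_vec n \<Longrightarrow> v \<in> W \<longleftrightarrow> (\<forall>i<n. i \<notin> S \<longrightarrow> (Q *\<^sub>v v) $ i = 0)"
      using subspace_adapted_coordinates[OF 3(1)] by metis
    have Wsub: "W \<subseteq> carrier_vec n" and W0: "0\<^sub>v n \<in> W" using 3(1) unfolding subspace_vec_iff by auto
    have finS: "finite S" using S finite_subset by blast
    have "S \<noteq> {..<n}"
    proof
      assume "S = {..<n}"
      then have "carrier_vec n \<subseteq> W" using W by auto
      with Wsub 3(4) show False by blast
    qed
    then have lt1: "card S < n" using S by (metis card_lessThan finite_lessThan psubsetI psubset_card_mono)
    have "S \<noteq> {}"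
    proof
      assume "S = {}"
      have "w = 0\<^sub>v n" if w: "w \<in> W" for w
      proof -
        have wc: "w \<in> carrier_vec n" using w Wsub by blast
        then have "Q *\<^sub>v w = 0\<^sub>v n" using W[OF wc] w Q \<open>S = {}\<close> by (intro eq_vecI) auto
        then have "(P * Q) *\<^sub>v w = P *\<^sub>v 0\<^sub>v n" using assoc_mult_mat_vec[OF P Q wc] by simp
        also have "\<dots> = 0\<^sub>v n" using P by auto
        finally show ?thesis using PQ wc by simp
      qed
      with W0 3(3) show False by blast
    qed
    then have "card S > 0" using finS by (simp add: card_gt_0_iff)
    then have lt2: "card ({..<n} - S) < n"
      using S lt1 by (simp add: card_Diff_subset[OF finS])
    let ?M = "\<lambda>g. Q * \<rho> g * P"
    note M = representation_conjugate[OF less.prems P Q PQ QP]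
    have zero: "?M g $$ (i, j) = 0" if g: "g \<in> carrier G" and i: "i < n" "i \<notin> S" and j: "j \<in> S" for g i j
    proof -
      have jn: "j < n" using j S by auto
      have Rg: "\<rho> g \<in> carrier_mat n n" using R g by blast
      define p where "p = P *\<^sub>v unit_vec n j"
      have pc: "p \<in> carrier_vec n" using P by (auto simp: p_def)
      have "Q *\<^sub>v p = unit_vec n j"
        using assoc_mult_mat_vec[OF Q P unit_vec_carrier, of j] QP by (simp add: p_def)
      then have "p \<in> W" using W[OF pc] j jn by auto
      then have "\<rho> g *\<^sub>v p \<in> W" using 3(2) g by blast
      then have "(Q *\<^sub>v (\<rho> g *\<^sub>v p)) $ i = 0" using W i Wsub by blast
      moreover have "?M g *\<^sub>v unit_vec n j = Q *\<^sub>v (\<rho> g *\<^sub>v p)"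
        using assoc_mult_mat_vec[OF mult_carrier_mat[OF Q Rg] P unit_vec_carrier, of j]
          assoc_mult_mat_vec[OF Q Rg pc] by (simp add: p_def)
      moreover have "?M g $$ (i, j) = (?M g *\<^sub>v unit_vec n j) $ i"
        using i jn P Q Rg by (auto simp: scalar_prod_right_unit)
      ultimately show ?thesis by simp
    qed
    have b1: "\<And>g h i j l. g \<in> carrier G \<Longrightarrow> h \<in> carrier G \<Longrightarrow> i \<in> S \<Longrightarrow> j \<in> S \<Longrightarrow> l < n
        \<Longrightarrow> l \<notin> S \<Longrightarrow> ?M g $$ (i, l) * ?M h $$ (l, j) = 0"
      using zero by simp
    obtain \<sigma> where \<sigma>: "representation G (card S) \<sigma>"
      "\<And>g. g \<in> carrier G \<Longrightarrow> character_of G (card S) \<sigma> g = (\<Sum>i\<in>S. ?M g $$ (i, i))"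
      using block_representation[OF M(1) S b1] by blast
    have b2: "\<And>g h i j l. g \<in> carrier G \<Longrightarrow> h \<in> carrier G \<Longrightarrow> i \<in> {..<n} - S \<Longrightarrow> j \<in> {..<n} - S \<Longrightarrow> l < n
        \<Longrightarrow> l \<notin> {..<n} - S \<Longrightarrow> ?M g $$ (i, l) * ?M h $$ (l, j) = 0"
      using zero by simp
    obtain \<tau> where \<tau>: "representation G (card ({..<n} - S)) \<tau>"
      "\<And>g. g \<in> carrier G \<Longrightarrow> character_of G (card ({..<n} - S)) \<tau> g = (\<Sum>i\<in>{..<n} - S. ?M g $$ (i, i))"
      using block_representation[OF M(1) Diff_subset b2] by blast
    obtain \<chi>s where \<chi>s: "set \<chi>s \<subseteq> Irr G" "\<forall>g\<in>carrier G. character_of G (card S) \<sigma> g = (\<Sum>\<chi>\<leftarrow>\<chi>s. \<chi> g)"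
      using less.IH[OF lt1 \<sigma>(1)] by blast
    obtain \<psi>s where \<psi>s: "set \<psi>s \<subseteq> Irr G"
      "\<forall>g\<in>carrier G. character_of G (card ({..<n} - S)) \<tau> g = (\<Sum>\<chi>\<leftarrow>\<psi>s. \<chi> g)"
      using less.IH[OF lt2 \<tau>(1)] by blast
    have "character_of G n \<rho> g = (\<Sum>\<chi>\<leftarrow>\<chi>s @ \<psi>s. \<chi> g)" if g: "g \<in> carrier G" for g
    proof -
      have "character_of G n \<rho> g = (\<Sum>i<n. ?M g $$ (i, i))"
        using g unfolding M(2)[symmetric] by (simp add: character_of_def)
      also have "\<dots> = (\<Sum>i\<in>{..<n} - S. ?M g $$ (i, i)) + (\<Sum>i\<in>S. ?M g $$ (i, i))"
        by (rule sum.subset_diff[OF S]) simp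
      finally show ?thesis using \<chi>s(2) \<psi>s(2) \<sigma>(2)[OF g] \<tau>(2)[OF g] g by simp
    qed
    then show ?thesis using \<chi>s(1) \<psi>s(1) by (intro exI[of _ "\<chi>s @ \<psi>s"]) auto
  qed
qed

section \<open>The regular character\<close>

lemma (in group) regular_representation:
  assumes fin: "finite (carrier G)"
  obtains \<rho> where "representation G (Coset.order G) \<rho>"
    "\<And>x. x \<in> carrier G \<Longrightarrow>
      character_of G (Coset.order G) \<rho> x = (if x = \<one> then of_nat (Coset.order G) else 0)"
proof -
  let ?N = "Coset.order G"
  obtain e where e: "bij_betw e {..<?N} (carrier G)"
    using ex_bij_betw_nat_finite[OF fin] by (auto simp: lessThan_atLeast0 Coset.order_def)
  have eG: "e i \<in> carrier G" if "i < ?N" for i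
    using e that by (auto simp: bij_betw_def)
  have einj: "e i = e j \<longleftrightarrow> i = j" if "i < ?N" "j < ?N" for i j
    using e that by (auto simp: bij_betw_def inj_on_def)
  define \<rho> where "\<rho> x = mat ?N ?N (\<lambda>(i, l). if e i = x \<otimes> e l then 1 else 0 :: complex)" for x
  have \<rho>c: "\<rho> x \<in> carrier_mat ?N ?N" for x by (simp add: \<rho>_def)
  have "representation G ?N \<rho>"
    unfolding representation_iff
  proof (intro conjI ballI)
    show "\<rho> x \<in> carrier_mat ?N ?N" for x by (rule \<rho>c)
    show "\<rho> \<one> = 1\<^sub>m ?N"
      by (intro eq_matI) (auto simp: \<rho>_def eG einj)
    fix x y assume x: "x \<in> carrier G" and y: "y \<in> carrier G"
    show "\<rho> (x \<otimes> y) = \<rho> x * \<rho> y"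
    proof (rule eq_matI)
      fix i l assume "i < dim_row (\<rho> x * \<rho> y)" "l < dim_col (\<rho> x * \<rho> y)"
      then have il: "i < ?N" "l < ?N" by (auto simp: \<rho>_def)
      have "(\<rho> x * \<rho> y) $$ (i, l) = (\<Sum>p<?N. \<rho> x $$ (i, p) * \<rho> y $$ (p, l))"
        by (rule mult_mat_index_sum[OF \<rho>c \<rho>c il])
      also have "\<dots> = (\<Sum>p<?N. (\<lambda>z. if z = y \<otimes> e l then (if e i = x \<otimes> z then 1 else 0) else 0) (e p))"
        by (rule sum.cong) (use il in \<open>auto simp: \<rho>_def\<close>)
      also have "\<dots> = (\<Sum>z\<in>carrier G. if z = y \<otimes> e l then (if e i = x \<otimes> z then 1 else 0) else 0)"
        by (rule sum.reindex_bij_betw[OF e])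
      also have "\<dots> = \<rho> (x \<otimes> y) $$ (i, l)"
        using fin eG[OF il(2)] x y il by (simp add: \<rho>_def m_assoc)
      finally show "\<rho> (x \<otimes> y) $$ (i, l) = (\<rho> x * \<rho> y) $$ (i, l)" ..
    qed (auto simp: \<rho>_def)
  qed
  moreover have "character_of G ?N \<rho> x = (if x = \<one> then of_nat ?N else 0)" if x: "x \<in> carrier G" for x
  proof -
    have "character_of G ?N \<rho> x = (\<Sum>i<?N. if x = \<one> then 1 else 0)"
      using x eG by (auto simp: character_of_def \<rho>_def intro!: sum.cong)
    then show ?thesis by simp
  qed
  ultimately show thesis by (rule that)
qed

lemma sum_list_map_eq_sum_multiplicity:
  fixes f :: "'a \<Rightarrow> 'b::comm_semiring_1"
  assumes "finite A" "set xs \<subseteq> A"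
  shows "(\<Sum>x\<leftarrow>xs. f x) = (\<Sum>x\<in>A. of_nat (count_list xs x) * f x)"
  using assms(2)
proof (induction xs)
  case (Cons y xs)
  have "(\<Sum>x\<in>A. of_nat (count_list (y # xs) x) * f x) =
      (\<Sum>x\<in>A. (if x = y then f x else 0) + of_nat (count_list xs x) * f x)"
    by (rule sum.cong) (auto simp: algebra_simps)
  then show ?case using Cons assms(1) by (simp add: sum.distrib)
qed simp

text \<open>
  The multiplicity of \<open>\<psi>\<close> in the regular character is its degree: the unnormalised scalar product of \<open>\<psi>\<close> with the
  regular character is \<open>|G| \<psi>(1)\<close>, because the latter vanishes off the identity, and also \<open>|G|\<close> times
  the multiplicity, by orthonormality. Degrees are positive, so every irreducible character occurs;
  this also bounds their number.
\<close>

theorem (in group) regular_character_decomposition: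
  assumes fin: "finite (carrier G)"
  shows "finite (Irr G)"
    and "x \<in> carrier G \<Longrightarrow> (\<Sum>\<chi>\<in>Irr G. \<chi> \<one> * \<chi> x) = (if x = \<one> then of_nat (Coset.order G) else 0)"
proof -
  let ?N = "Coset.order G"
  obtain \<rho> where \<rho>: "representation G ?N \<rho>"
    "\<And>x. x \<in> carrier G \<Longrightarrow> character_of G ?N \<rho> x = (if x = \<one> then of_nat ?N else 0)"
    using regular_representation[OF fin] by metis
  obtain \<chi>s where \<chi>s: "set \<chi>s \<subseteq> Irr G" "\<forall>g\<in>carrier G. character_of G ?N \<rho> g = (\<Sum>\<chi>\<leftarrow>\<chi>s. \<chi> g)"
    using character_sum_of_irreducibles[OF \<rho>(1)] by blast
  have N: "?N > 0" using fin by (simp add: order_gt_0_iff_finite)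
  have mult: "of_nat (count_list \<chi>s \<psi>) = \<psi> \<one>" if \<psi>: "\<psi> \<in> Irr G" for \<psi>
  proof -
    let ?A = "insert \<psi> (set \<chi>s)"
    have A: "?A \<subseteq> Irr G" using \<psi> \<chi>s(1) by blast
    have dec: "character_of G ?N \<rho> g = (\<Sum>\<chi>\<in>?A. of_nat (count_list \<chi>s \<chi>) * \<chi> g)" if "g \<in> carrier G" for g
      using \<chi>s(2) that sum_list_map_eq_sum_multiplicity[of ?A \<chi>s "\<lambda>\<chi>. \<chi> g"] by auto
    have "of_nat ?N * \<psi> \<one> = (\<Sum>g\<in>carrier G. (if g = \<one> then of_nat ?N * \<psi> \<one> else 0))"
      using fin by simp
    also have "\<dots> = (\<Sum>g\<in>carrier G. character_of G ?N \<rho> g * \<psi> (inv g))"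
      by (rule sum.cong) (auto simp: \<rho>(2))
    also have "\<dots> = (\<Sum>g\<in>carrier G. \<Sum>\<chi>\<in>?A. of_nat (count_list \<chi>s \<chi>) * (\<chi> g * \<psi> (inv g)))"
      by (rule sum.cong[OF refl]) (simp only: dec sum_distrib_right mult.assoc)
    also have "\<dots> = (\<Sum>\<chi>\<in>?A. of_nat (count_list \<chi>s \<chi>) * (\<Sum>g\<in>carrier G. \<chi> g * \<psi> (inv g)))"
      by (subst sum.swap) (simp only: sum_distrib_left)
    also have "\<dots> = (\<Sum>\<chi>\<in>?A. if \<chi> = \<psi> then of_nat (count_list \<chi>s \<chi>) * of_nat ?N else 0)"
    proof (rule sum.cong[OF refl])
      fix \<chi> assume "\<chi> \<in> ?A"
      then have "\<chi> \<in> Irr G" using A by blast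
      then show "of_nat (count_list \<chi>s \<chi>) * (\<Sum>g\<in>carrier G. \<chi> g * \<psi> (inv g)) =
          (if \<chi> = \<psi> then of_nat (count_list \<chi>s \<chi>) * of_nat ?N else 0)"
        by (simp add: irreducible_characters_orthonormal[OF fin _ \<psi>])
    qed
    also have "\<dots> = of_nat (count_list \<chi>s \<psi>) * of_nat ?N" by (simp add: sum.delta)
    finally show ?thesis using N by simp
  qed
  have "Irr G \<subseteq> set \<chi>s"
  proof
    fix \<psi> assume \<psi>: "\<psi> \<in> Irr G"
    then obtain n \<sigma> where \<sigma>: "irreducible_representation G n \<sigma>" "\<psi> = character_of G n \<sigma>"
      by (auto simp: Irr_def)
    have "\<psi> \<one> = of_nat n"
      using irreducible_representationD(1)[OF \<sigma>(1)] by (simp add: \<sigma>(2) character_of_def representation_iff)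
    then have "count_list \<chi>s \<psi> \<noteq> 0"
      using mult[OF \<psi>] irreducible_representationD(2)[OF \<sigma>(1)] by auto
    then show "\<psi> \<in> set \<chi>s" using count_list_0_iff by metis
  qed
  then have Irr_eq: "Irr G = set \<chi>s" using \<chi>s(1) by blast
  show "finite (Irr G)" unfolding Irr_eq by simp
  assume x: "x \<in> carrier G"
  have "(\<Sum>\<chi>\<in>Irr G. \<chi> \<one> * \<chi> x) = (\<Sum>\<chi>\<in>set \<chi>s. of_nat (count_list \<chi>s \<chi>) * \<chi> x)"
    unfolding Irr_eq by (rule sum.cong) (use mult Irr_eq in auto)
  also have "\<dots> = character_of G ?N \<rho> x"
    using \<chi>s(2) x sum_list_map_eq_sum_multiplicity[of "set \<chi>s" \<chi>s "\<lambda>\<chi>. \<chi> x"] by simp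
  finally show "(\<Sum>\<chi>\<in>Irr G. \<chi> \<one> * \<chi> x) = (if x = \<one> then of_nat ?N else 0)"
    using \<rho>(2)[OF x] by simp
qed

section \<open>Character values as sums of roots of unity\<close>

lemma upper_triangular_pow:
  fixes B :: "'a::comm_ring_1 mat"
  assumes B: "B \<in> carrier_mat n n" and ut: "upper_triangular B"
  shows "upper_triangular (B ^\<^sub>m s)" and "i < n \<Longrightarrow> (B ^\<^sub>m s) $$ (i, i) = (B $$ (i, i)) ^ s"
proof -
  have "upper_triangular (B ^\<^sub>m s) \<and> (\<forall>i<n. (B ^\<^sub>m s) $$ (i, i) = (B $$ (i, i)) ^ s)"
  proof (induction s)
    case 0
    then show ?case using B by simp
  next
    case (Suc s)
    let ?C = "B ^\<^sub>m s"
    have C: "?C \<in> carrier_mat n n" using B by simp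
    have entry: "(B ^\<^sub>m Suc s) $$ (i, j) = (\<Sum>l<n. ?C $$ (i, l) * B $$ (l, j))" if "i < n" "j < n" for i j
      using mult_mat_index_sum[OF C B that] by simp
    have low: "?C $$ (i, l) = 0" if "l < i" "i < n" for i l
      using Suc.IH that B upper_triangularD[of ?C l i] by simp
    have low': "B $$ (i, l) = 0" if "l < i" "i < n" for i l
      using ut that B upper_triangularD[of B l i] by simp
    have "(B ^\<^sub>m Suc s) $$ (i, j) = 0" if "j < i" "i < n" for i j
    proof -
      have "?C $$ (i, l) * B $$ (l, j) = 0" if "l < n" for l
        using low[of l i] low'[of j l] \<open>j < i\<close> \<open>i < n\<close> that by (cases "l < i") auto
      then show ?thesis using entry[of i j] that by simp
    qed
    moreover have "(B ^\<^sub>m Suc s) $$ (i, i) = (B $$ (i, i)) ^ Suc s" if i: "i < n" for i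
    proof -
      have "?C $$ (i, l) * B $$ (l, i) = (if l = i then (B $$ (i, i)) ^ Suc s else 0)" if "l < n" for l
        using low[of l i] low'[of i l] Suc.IH i that by (cases l i rule: linorder_cases) auto
      then show ?thesis using entry[OF i i] i by simp
    qed
    ultimately show ?case using B by (auto intro!: upper_triangularI)
  qed
  then show "upper_triangular (B ^\<^sub>m s)" "i < n \<Longrightarrow> (B ^\<^sub>m s) $$ (i, i) = (B $$ (i, i)) ^ s"
    by auto
qed

text \<open>
  In a triangular form of \<open>\<rho> b\<close> the diagonal of a power consists of the powers of the diagonal
  entries, so these behave in traces as if \<open>\<rho> b\<close> were diagonal.
\<close>

lemma (in group) character_at_powers:
  assumes \<rho>: "representation G n \<rho>" and b: "b \<in> carrier G" and m: "b [^] (m::nat) = \<one>"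
  obtains d where "\<And>i. i < n \<Longrightarrow> d i ^ m = 1"
    "\<And>s. character_of G n \<rho> (b [^] (s::nat)) = (\<Sum>i<n. d i ^ s)"
proof -
  note R = \<rho>[unfolded representation_iff]
  let ?A = "\<rho> b"
  have A: "?A \<in> carrier_mat n n" using R b by blast
  have pow: "\<rho> (b [^] (s::nat)) = ?A ^\<^sub>m s" for s
    by (induction s) (use R b A in auto)
  obtain es where "char_poly ?A = (\<Prod>a\<leftarrow>es. [:- a, 1:])"
    using char_poly_factorized[OF A] by blast
  then obtain B where B: "B \<in> carrier_mat n n" "upper_triangular B" "similar_mat ?A B"
    using schur_decomposition_exists[OF A] by blast
  from B(3) obtain P Q where wit: "similar_mat_wit ?A B P Q" by (auto simp: similar_mat_def)
  have powB: "?A ^\<^sub>m s = P * B ^\<^sub>m s * Q" for s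
    by (rule similar_mat_wit_pow_id[OF wit])
  have PQ: "P \<in> carrier_mat n n" "Q \<in> carrier_mat n n" "P * Q = 1\<^sub>m n" "Q * P = 1\<^sub>m n"
    using similar_mat_witD2[OF A wit] by auto
  have diag: "(B ^\<^sub>m s) $$ (i, i) = (B $$ (i, i)) ^ s" if "i < n" for i s
    by (rule upper_triangular_pow(2)[OF B(1,2) that])
  have Bm: "B ^\<^sub>m m = 1\<^sub>m n"
  proof -
    have "1\<^sub>m n = P * B ^\<^sub>m m * Q" using pow[of m] m R powB[of m] by simp
    then have "Q * 1\<^sub>m n * P = Q * (P * B ^\<^sub>m m * Q) * P" by simp
    also have "\<dots> = (Q * P) * B ^\<^sub>m m * (Q * P)"
    proof -
      have C: "B ^\<^sub>m m \<in> carrier_mat n n" using B by simp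
      note c = PQ(1,2) C mult_carrier_mat[OF PQ(1) C] mult_carrier_mat[OF PQ(2,1)] mult_carrier_mat[OF C PQ(2)]
        mult_carrier_mat[OF C mult_carrier_mat[OF PQ(2,1)]] mult_carrier_mat[OF mult_carrier_mat[OF PQ(1) C] PQ(2)]
      show ?thesis using c by (simp add: assoc_mult_mat[of _ n n _ n _ n])
    qed
    finally show ?thesis using PQ B by simp
  qed
  show thesis
  proof (rule that)
    show "B $$ (i, i) ^ m = 1" if "i < n" for i
      using diag[OF that, of m] Bm that by simp
    fix s :: nat
    have "character_of G n \<rho> (b [^] s) = mat_trace (P * B ^\<^sub>m s * Q)"
      using character_of_eq_mat_trace[OF \<rho>] b pow powB by simp
    also have "\<dots> = mat_trace (B ^\<^sub>m s)"
      by (rule mat_trace_conjugate[of _ n _ n]) (use PQ B in auto)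
    also have "\<dots> = (\<Sum>i<n. B $$ (i, i) ^ s)"
      using B diag by (simp add: mat_trace_def)
    finally show "character_of G n \<rho> (b [^] s) = (\<Sum>i<n. B $$ (i, i) ^ s)" .
  qed
qed

lemma norm_root_of_unity:
  fixes d :: complex
  assumes "d ^ m = 1" "m > 0"
  shows "norm d = 1"
proof -
  have "norm d ^ m = 1" using assms by (simp flip: norm_power)
  then show ?thesis using power_eq_imp_eq_base[of "norm d" m 1] assms(2) by simp
qed

lemma (in group) Irr_degree:
  assumes "\<chi> \<in> Irr G"
  obtains n where "n > 0" "\<chi> \<one> = of_nat n"
proof -
  obtain n \<rho> where \<rho>: "irreducible_representation G n \<rho>" "\<chi> = character_of G n \<rho>"
    using assms by (auto simp: Irr_def)
  show thesis
    by (rule that[OF irreducible_representationD(2)[OF \<rho>(1)]])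
       (use irreducible_representationD(1)[OF \<rho>(1)] in \<open>simp add: \<rho>(2) character_of_def representation_iff\<close>)
qed

lemma (in group) Irr_at_powers:
  assumes \<chi>: "\<chi> \<in> Irr G" and b: "b \<in> carrier G"
  shows "\<exists>n d. \<chi> \<one> = of_nat n \<and> (\<forall>i<n. d i ^ ord b = 1) \<and>
    (\<forall>s. \<chi> (b [^] (s::nat)) = (\<Sum>i<n. d i ^ s))"
proof -
  obtain n \<rho> where \<rho>: "irreducible_representation G n \<rho>" "\<chi> = character_of G n \<rho>"
    using \<chi> by (auto simp: Irr_def)
  obtain d where d: "\<And>i. i < n \<Longrightarrow> d i ^ ord b = 1"
    "\<And>s. \<chi> (b [^] (s::nat)) = (\<Sum>i<n. d i ^ s)"
    using character_at_powers[OF irreducible_representationD(1)[OF \<rho>(1)] b pow_ord_eq_1[OF b]]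
    unfolding \<rho>(2) by blast
  have "\<chi> \<one> = of_nat n" using d(2)[of 0] by simp
  with d show ?thesis by blast
qed

lemma (in group) Irr_norm_le_degree:
  assumes fin: "finite (carrier G)" and \<chi>: "\<chi> \<in> Irr G" and b: "b \<in> carrier G"
  shows "norm (\<chi> b) \<le> norm (\<chi> \<one>)"
proof -
  obtain n d where d: "\<chi> \<one> = of_nat n" "\<forall>i<n. d i ^ ord b = 1"
    "\<forall>s. \<chi> (b [^] (s::nat)) = (\<Sum>i<n. d i ^ s)"
    using Irr_at_powers[OF \<chi> b] by blast
  have "norm (d i) = 1" if "i < n" for i
    using norm_root_of_unity[of "d i" "ord b"] d(2) that ord_ge_1[OF fin b] by simp
  then have "norm (\<Sum>i<n. d i) \<le> of_nat n"
    using norm_sum[of d "{..<n}"] by simp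
  then show ?thesis using d(3)[rule_format, of 1] d(1) b by simp
qed

text \<open>
  The kernel of a character is closed under powers: \<open>n\<close> numbers of absolute value 1 have sum \<open>n\<close> only
  if all of them are 1.
\<close>

lemma (in group) Irr_eq_degree_at_powers:
  assumes fin: "finite (carrier G)" and \<chi>: "\<chi> \<in> Irr G" and b: "b \<in> carrier G"
    and ker: "\<chi> b = \<chi> \<one>"
  shows "\<chi> (b [^] (s::nat)) = \<chi> \<one>"
proof -
  obtain n d where d: "\<chi> \<one> = of_nat n" "\<forall>i<n. d i ^ ord b = 1"
    "\<forall>s. \<chi> (b [^] (s::nat)) = (\<Sum>i<n. d i ^ s)"
    using Irr_at_powers[OF \<chi> b] by blast
  have norm1: "norm (d i) = 1" if "i < n" for i
    using norm_root_of_unity[of "d i" "ord b"] d(2) that ord_ge_1[OF fin b] by simp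
  have "(\<Sum>i<n. d i) = of_nat n" using d(3)[rule_format, of 1] d(1) b ker by simp
  then have "(\<Sum>i<n. Re (d i)) = real n" by (simp flip: Re_sum)
  then have "(\<Sum>i<n. 1 - Re (d i)) = 0" by (simp add: sum_subtractf)
  moreover have "1 - Re (d i) \<ge> 0" if "i < n" for i
    using complex_Re_le_cmod[of "d i"] norm1[OF that] by simp
  ultimately have "Re (d i) = 1" if "i < n" for i
    using that by (subst (asm) sum_nonneg_eq_0_iff) auto
  then have "d i = 1" if "i < n" for i
    using that norm1[OF that] by (simp add: complex_eq_iff cmod_def)
  then show ?thesis using d(1,3) by simp
qed

lemma sum_powers_root_of_unity:
  fixes r :: complex
  assumes "r ^ m = 1"
  shows "(\<Sum>s<m. r ^ s) = (if r = 1 then of_nat m else 0)"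
  using assms by (simp add: geometric_sum)

text \<open>
  Fourier inversion on the integers modulo \<open>m\<close> computes the multiplicity \<open>N(\<omega>)\<close> of \<open>\<omega>\<close> among the
  \<open>d i\<close> from the power sums: \<open>m N(1) = n - \<beta> + m \<beta>\<close> and \<open>m N(\<omega>) = n - \<beta>\<close> for \<open>\<omega> \<noteq> 1\<close>. Hence
  \<open>\<beta> = N(1) - N(\<omega>)\<close> for any \<open>m\<close>-th root of unity \<open>\<omega> \<noteq> 1\<close>.
\<close>

lemma power_sums_constant_imp_integer:
  fixes d :: "nat \<Rightarrow> complex"
  assumes m: "m > 1" and roots: "\<And>i. i < n \<Longrightarrow> d i ^ m = 1"
    and const: "\<And>s. 0 < s \<Longrightarrow> s < m \<Longrightarrow> (\<Sum>i<n. d i ^ s) = \<beta>"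
  shows "\<beta> \<in> \<int>"
proof -
  have count: "of_nat m * of_nat (card {i. i < n \<and> d i = \<omega>}) = of_nat n - \<beta> + (if \<omega> = 1 then of_nat m * \<beta> else 0)"
    if \<omega>: "\<omega> ^ m = 1" for \<omega>
  proof -
    have \<omega>0: "\<omega> \<noteq> 0" using \<omega> m by (auto simp: power_0_left)
    have "of_nat m * of_nat (card {i. i < n \<and> d i = \<omega>}) = (\<Sum>i<n. (if d i = \<omega> then of_nat m else 0 :: complex))"
      by (simp add: sum.If_cases Int_def lessThan_def mult.commute)
    also have "\<dots> = (\<Sum>i<n. \<Sum>s<m. (d i / \<omega>) ^ s)"
    proof (rule sum.cong[OF refl])
      fix i assume "i \<in> {..<n}"
      then have "(d i / \<omega>) ^ m = 1" using \<omega> roots by (simp add: power_divide)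
      then show "(if d i = \<omega> then of_nat m else 0) = (\<Sum>s<m. (d i / \<omega>) ^ s)"
        using \<omega>0 by (subst sum_powers_root_of_unity) auto
    qed
    also have "\<dots> = (\<Sum>s<m. (1 / \<omega>) ^ s * (\<Sum>i<n. d i ^ s))"
      by (subst sum.swap) (simp add: sum_distrib_left power_divide)
    also have "\<dots> = (\<Sum>s<m. (if s = 0 then of_nat n - \<beta> else 0) + (1 / \<omega>) ^ s * \<beta>)"
      by (rule sum.cong) (use const in auto)
    also have "\<dots> = of_nat n - \<beta> + (\<Sum>s<m. (1 / \<omega>) ^ s) * \<beta>"
      using m by (simp add: sum.distrib sum_distrib_right)
    also have "(\<Sum>s<m. (1 / \<omega>) ^ s) = (if \<omega> = 1 then of_nat m else 0)"
      using \<omega> \<omega>0 by (subst sum_powers_root_of_unity) (auto simp: power_divide)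
    finally show ?thesis by simp
  qed
  show ?thesis
  \<comment> \<open>a \<open>d i \<noteq> 1\<close>, if there is one, serves as the root of unity to compare with\<close>
  proof (cases "\<forall>i<n. d i = 1")
    case True
    then have "\<beta> = of_nat n" using const[of 1] m by simp
    then show ?thesis by simp
  next
    case False
    then obtain i where i: "i < n" "d i \<noteq> 1" by blast
    let ?c = "\<lambda>\<omega>. of_nat (card {i. i < n \<and> d i = \<omega>}) :: complex"
    have "of_nat m * ?c 1 = of_nat n - \<beta> + of_nat m * \<beta>" using count[of 1] by simp
    moreover have "of_nat m * ?c (d i) = of_nat n - \<beta>" using count[OF roots[OF i(1)]] i(2) by simp
    ultimately have "of_nat m * (?c 1 - ?c (d i)) = of_nat m * \<beta>"
      by (simp only: right_diff_distrib) simp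
    then have "\<beta> = ?c 1 - ?c (d i)" using m by simp
    then show ?thesis by simp
  qed
qed

section \<open>Special classes\<close>

lemma (in group) Irr_conj_class:
  assumes "\<chi> \<in> Irr G" "y \<in> carrier G" "z \<in> conj_class G y"
  shows "z \<in> carrier G" "\<chi> z = \<chi> y"
proof -
  obtain n \<rho> where \<rho>: "irreducible_representation G n \<rho>" "\<chi> = character_of G n \<rho>"
    using assms(1) by (auto simp: Irr_def)
  note rep = irreducible_representationD(1)[OF \<rho>(1)]
  note R = rep[unfolded representation_iff]
  obtain g where g: "g \<in> carrier G" "z = inv g \<otimes> y \<otimes> g" using assms(3) by (auto simp: conj_class_def)
  show z: "z \<in> carrier G" using g assms(2) by simp
  have inv1: "\<rho> g * \<rho> (inv g) = 1\<^sub>m n" using R g by (metis inv_closed r_inv)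
  have "mat_trace (\<rho> z) = mat_trace (\<rho> (inv g) * \<rho> y * \<rho> g)" using g assms(2) R by simp
  also have "\<dots> = mat_trace (\<rho> y)"
    by (rule mat_trace_conjugate[of _ n _ n]) (use R g assms(2) inv1 in auto)
  finally show "\<chi> z = \<chi> y"
    using character_of_eq_mat_trace[OF rep] z assms(2) by (simp add: \<rho>(2))
qed

lemma Irr_enumerationD:
  assumes "Irr_enumeration G k chi"
  shows "bij_betw chi {1..k} (Irr G)" "chi 1 = principal_character G"
    "i \<in> {1..k} \<Longrightarrow> chi i \<in> Irr G"
    "i \<in> {1..k} \<Longrightarrow> i' \<in> {1..k} \<Longrightarrow> i \<le> i' \<Longrightarrow> chi i \<one>\<^bsub>G\<^esub> \<le> chi i' \<one>\<^bsub>G\<^esub>"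
proof -
  show bij: "bij_betw chi {1..k} (Irr G)" and "chi 1 = principal_character G"
    using assms unfolding Irr_enumeration_def by blast+
  show "i \<in> {1..k} \<Longrightarrow> chi i \<in> Irr G" by (rule bij_betw_apply[OF bij])
  show "i \<in> {1..k} \<Longrightarrow> i' \<in> {1..k} \<Longrightarrow> i \<le> i' \<Longrightarrow> chi i \<one>\<^bsub>G\<^esub> \<le> chi i' \<one>\<^bsub>G\<^esub>"
    using assms unfolding Irr_enumeration_def by blast
qed

lemma (in group) Irr_enumeration_column_relation:
  assumes fin: "finite (carrier G)" and enum: "Irr_enumeration G k chi" and x: "x \<in> carrier G"
  shows "(\<Sum>i\<in>{1..k}. chi i \<one> * chi i x) = (if x = \<one> then of_nat (Coset.order G) else 0)"
proof -
  have "(\<Sum>i\<in>{1..k}. chi i \<one> * chi i x) = (\<Sum>\<chi>\<in>Irr G. \<chi> \<one> * \<chi> x)"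
    by (rule sum.reindex_bij_betw[OF Irr_enumerationD(1)[OF enum]])
  also have "\<dots> = (if x = \<one> then of_nat (Coset.order G) else 0)"
    by (rule regular_character_decomposition(2)[OF fin x])
  finally show ?thesis .
qed

lemma (in group) conj_class_one: "conj_class G \<one> = {\<one>}"
  by (auto simp: conj_class_def intro!: exI[of _ \<one>])

text \<open>
  Otherwise the columns of \<open>a\<close> and \<open>b\<close> are both orthogonal to the column of the identity. As they
  differ in the \<open>j\<close>-th entry only, this contradicts \<open>\<chi>\<^sub>j(1) \<noteq> 0\<close>.
\<close>

lemma (in group) special_pair_contains_identity:
  assumes fin: "finite (carrier G)" and enum: "Irr_enumeration G k chi"
    and a: "a \<in> carrier G" and b: "b \<in> carrier G" and j: "j \<in> {1..k}"
    and differ: "chi j a \<noteq> chi j b"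
    and agree: "\<forall>i\<in>{1..k} - {j}. chi i a = chi i b"
  shows "a = \<one> \<or> b = \<one>"
proof (rule ccontr)
  assume "\<not> (a = \<one> \<or> b = \<one>)"
  then have ab: "a \<noteq> \<one>" "b \<noteq> \<one>" by auto
  have "chi j \<in> Irr G" by (rule Irr_enumerationD(3)[OF enum j])
  then obtain n where n: "n > 0" "chi j \<one> = of_nat n" using Irr_degree by blast
  let ?rest = "\<Sum>i\<in>{1..k} - {j}. chi i \<one> * chi i b"
  have split: "chi j \<one> * chi j x + (\<Sum>i\<in>{1..k} - {j}. chi i \<one> * chi i x) = 0"
    if "x \<in> carrier G" "x \<noteq> \<one>" for x
    using Irr_enumeration_column_relation[OF fin enum that(1)] that(2) j
    by (simp add: sum.remove)
  have "(\<Sum>i\<in>{1..k} - {j}. chi i \<one> * chi i a) = ?rest"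
    by (rule sum.cong) (use agree in auto)
  then have "chi j \<one> * chi j a + ?rest = chi j \<one> * chi j b + ?rest"
    using split[OF a ab(1)] split[OF b ab(2)] by (simp only:)
  then have "chi j \<one> * chi j a = chi j \<one> * chi j b" by (rule add_right_imp_eq)
  then show False using n differ by simp
qed

text \<open>
  The numerical part of the result, stated with natural numbers and integers so that the estimates
  take place in a linear order.
\<close>

lemma (in group) special_partner_of_identity_integral:
  assumes fin: "finite (carrier G)" and large: "Coset.order G > 2"
    and enum: "Irr_enumeration G k chi"
    and y: "y \<in> carrier G" and j: "j \<in> {1..k}"
    and differ: "chi j \<one> \<noteq> chi j y"
    and agree: "\<forall>i\<in>{1..k} - {j}. chi i y = chi i \<one>"
  obtains D :: nat and E :: nat and c :: int
  where "j = k" "chi k \<one> = of_nat D" "chi (k - 1) \<one> = of_nat E" "1 \<le> E" "E < D"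
    "chi k y = of_int c" "- int D \<le> c" "c \<le> - 1"
    "int (Coset.order G) = (int D)\<^sup>2 - c * int D"
proof -
  let ?N = "Coset.order G"
  let ?R = "{1..k} - {j}"
  have Irr: "chi i \<in> Irr G" if "i \<in> {1..k}" for i
    by (rule Irr_enumerationD(3)[OF enum that])
  have "\<exists>n. n > 0 \<and> chi i \<one> = of_nat n" if "i \<in> {1..k}" for i
    by (rule Irr_degree[OF Irr[OF that]]) blast
  then have "\<exists>deg. \<forall>i\<in>{1..k}. deg i > 0 \<and> chi i \<one> = of_nat (deg i)"
    by (intro bchoice ballI)
  then obtain deg where deg: "\<And>i. i \<in> {1..k} \<Longrightarrow> deg i > 0" "\<And>i. i \<in> {1..k} \<Longrightarrow> chi i \<one> = of_nat (deg i)"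
    by blast
  define S where "S = (\<Sum>i\<in>?R. (deg i)\<^sup>2)"
  have col: "(\<Sum>i\<in>{1..k}. chi i \<one> * chi i z) = of_nat (deg j) * chi j z + of_nat S"
    if "\<forall>i\<in>?R. chi i z = chi i \<one>" for z
  proof -
    have "(\<Sum>i\<in>?R. chi i \<one> * chi i z) = of_nat S"
      unfolding S_def of_nat_sum by (rule sum.cong) (use that deg(2) in \<open>auto simp: power2_eq_square\<close>)
    moreover have "(\<Sum>i\<in>{1..k}. chi i \<one> * chi i z) = chi j \<one> * chi j z + (\<Sum>i\<in>?R. chi i \<one> * chi i z)"
      using j by (simp add: sum.remove)
    ultimately show ?thesis using deg(2)[OF j] by simp
  qed
  have N: "?N = (deg j)\<^sup>2 + S"
  proof -
    have "(of_nat ?N :: complex) = of_nat ((deg j)\<^sup>2 + S)"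
      using col[of \<one>] Irr_enumeration_column_relation[OF fin enum one_closed] deg(2)[OF j]
      by (simp add: power2_eq_square)
    then show ?thesis by (simp only: of_nat_eq_iff)
  qed
  have vanish: "of_nat (deg j) * chi j z = - of_nat S"
    if "z \<in> carrier G" "z \<noteq> \<one>" "\<forall>i\<in>?R. chi i z = chi i \<one>" for z
    using col[OF that(3)] Irr_enumeration_column_relation[OF fin enum that(1)] that(2)
    by (simp add: eq_neg_iff_add_eq_0)
  have y1: "y \<noteq> \<one>" using differ by auto
  have ordy: "ord y > 1" using ord_ge_1[OF fin y] ord_eq_1[OF y] y1 by linarith
  \<comment> \<open>the powers of \<open>y\<close> lie in the same kernels, so they satisfy the equation that determines \<open>chi j y\<close>\<close>
  have powers: "chi j (y [^] s) = chi j y" if s: "0 < s" "s < ord y" for s :: nat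
  proof -
    have "y [^] s \<noteq> \<one>" using pow_eq_id[OF y, of s] s by (auto dest: dvd_imp_le)
    moreover have "\<forall>i\<in>?R. chi i (y [^] s) = chi i \<one>"
      using Irr_eq_degree_at_powers[OF fin Irr y] agree by blast
    ultimately have "of_nat (deg j) * chi j (y [^] s) = of_nat (deg j) * chi j y"
      using vanish[of "y [^] s"] vanish[OF y y1] agree y by simp
    then show ?thesis using deg(1)[OF j] by simp
  qed
  have "chi j y \<in> \<int>"
  proof -
    obtain n d where "chi j \<one> = of_nat n"
      and d: "\<forall>i<n. d i ^ ord y = 1" "\<forall>s. chi j (y [^] (s::nat)) = (\<Sum>i<n. d i ^ s)"
      using Irr_at_powers[OF Irr[OF j] y] by blast
    show ?thesis
    proof (rule power_sums_constant_imp_integer[OF ordy])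
      show "d i ^ ord y = 1" if "i < n" for i using d(1) that by blast
      fix s assume s: "0 < s" "s < ord y"
      have "(\<Sum>i<n. d i ^ s) = chi j (y [^] s)" using d(2) by (simp only:)
      also have "\<dots> = chi j y" by (rule powers[OF s])
      finally show "(\<Sum>i<n. d i ^ s) = chi j y" .
    qed
  qed
  then obtain c where c: "chi j y = of_int c" by (auto elim: Ints_cases)
  have Sc: "int S = - c * int (deg j)"
  proof -
    have "of_nat (deg j) * of_int c = - (of_nat S :: complex)"
      using vanish[OF y y1 agree] unfolding c .
    then have "(of_int (int (deg j) * c) :: complex) = of_int (- int S)" by simp
    then have "int (deg j) * c = - int S" by (simp only: of_int_eq_iff)
    then have "int S = - (int (deg j) * c)" by simp
    then show ?thesis by (simp add: mult.commute)
  qed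
  have k1: "1 \<in> {1..k}" using j by auto
  have chi1: "chi 1 = principal_character G" by (rule Irr_enumerationD(2)[OF enum])
  \<comment> \<open>the principal character does not separate \<open>y\<close> from the identity\<close>
  have j1: "j \<noteq> 1"
  proof
    assume "j = 1"
    then have "chi j = principal_character G" using chi1 by (simp only:)
    then show False using differ y by (simp add: principal_character_def)
  qed
  have deg1: "deg 1 = 1"
    using deg(2)[OF k1] unfolding chi1 by (simp add: principal_character_def)
  have S1: "1 \<le> S"
    unfolding S_def using member_le_sum[of 1 ?R "\<lambda>i. (deg i)\<^sup>2"] k1 j1 deg1 by simp
  have cneg: "c \<le> - 1"
  proof -
    have "0 < - c * int (deg j)" using Sc S1 by linarith
    then show ?thesis using deg(1)[OF j] by (simp add: mult_less_0_iff)
  qed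
  have cge: "- int (deg j) \<le> c"
  proof -
    have "norm (chi j y) \<le> norm (chi j \<one>)" by (rule Irr_norm_le_degree[OF fin Irr[OF j] y])
    then have "\<bar>c\<bar> \<le> int (deg j)" unfolding c deg(2)[OF j] by (simp add: norm_of_int)
    then show ?thesis by linarith
  qed
  have Sle: "S \<le> (deg j)\<^sup>2"
  proof -
    have "int S \<le> int (deg j) * int (deg j)"
      unfolding Sc by (rule mult_right_mono) (use cge in auto)
    then have "int S \<le> int ((deg j)\<^sup>2)" by (simp add: power2_eq_square)
    then show ?thesis by (simp only: of_nat_le_iff)
  qed
  have small: "deg i < deg j" if i: "i \<in> ?R" for i
  proof (cases "i = 1")
    case True
    \<comment> \<open>for \<open>deg j = 1\<close> the estimate \<open>S \<le> (deg j)\<^sup>2\<close> bounds the order of the group by 2\<close>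
    have "deg j \<noteq> 1"
    proof
      assume "deg j = 1"
      then have "?N \<le> 2" using N Sle by simp
      then show False using large by simp
    qed
    then show ?thesis using True deg1 deg(1)[OF j] by simp
  next
    case False
    have "(deg 1)\<^sup>2 + (deg i)\<^sup>2 = (\<Sum>i\<in>{1, i}. (deg i)\<^sup>2)" using False by simp
    also have "\<dots> \<le> S"
      unfolding S_def by (rule sum_mono2) (use i k1 j1 in auto)
    finally have "(deg i)\<^sup>2 < (deg j)\<^sup>2" using Sle deg1 by simp
    then show ?thesis by (rule power_less_imp_less_base) simp
  qed
  have jk: "j = k"
  proof (rule ccontr)
    assume "j \<noteq> k"
    then have k: "k \<in> ?R" using j by auto
    have "chi j \<one> \<le> chi k \<one>"
      by (rule Irr_enumerationD(4)[OF enum j]) (use j in auto)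
    then have "deg j \<le> deg k" using deg(2)[of j] deg(2)[of k] j k by (simp add: less_eq_complex_def)
    then show False using small[OF k] by simp
  qed
  have k': "k - 1 \<in> ?R" using jk j j1 by auto
  show thesis
  proof (rule that[OF jk])
    show "chi k \<one> = of_nat (deg k)" "chi (k - 1) \<one> = of_nat (deg (k - 1))"
      using deg(2) k' j jk by auto
    show "1 \<le> deg (k - 1)" using deg(1)[of "k - 1"] k' by simp
    show "deg (k - 1) < deg k" using small[OF k'] jk by simp
    show "chi k y = of_int c" using c jk by simp
    show "- int (deg k) \<le> c" "c \<le> - 1" using cge cneg jk by auto
    show "int ?N = (int (deg k))\<^sup>2 - c * int (deg k)" using N Sc jk by simp
  qed
qed

lemma of_int_le_complex_iff: "(of_int m :: complex) \<le> of_int n \<longleftrightarrow> m \<le> n"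
  by (simp add: less_eq_complex_def)

lemma of_int_less_complex_iff: "(of_int m :: complex) < of_int n \<longleftrightarrow> m < n"
  by (simp add: less_complex_def)

lemma (in group) special_partner_of_identity:
  assumes fin: "finite (carrier G)" and large: "Coset.order G > 2"
    and enum: "Irr_enumeration G k chi"
    and y: "y \<in> carrier G" and j: "j \<in> {1..k}"
    and differ: "chi j \<one> \<noteq> chi j y"
    and agree: "\<forall>i\<in>{1..k} - {j}. chi i y = chi i \<one>"
  shows "j = k \<and> chi (k - 1) \<one> < chi k \<one> \<and> 1 \<le> chi (k - 1) \<one> \<and>
       chi k y \<in> \<int> \<and> - chi k \<one> \<le> chi k y \<and> chi k y \<le> - 1 \<and>
       of_nat (Coset.order G) = (chi k \<one>)\<^sup>2 - chi k y * chi k \<one> \<and>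
       (chi k \<one>)\<^sup>2 + chi k \<one> \<le> of_nat (Coset.order G) \<and>
       of_nat (Coset.order G) \<le> 2 * (chi k \<one>)\<^sup>2 \<and>
       {\<one>} \<union> conj_class G y \<subseteq> (\<Inter>i\<in>{1..k - 1}. char_kernel G (chi i))"
proof -
  obtain D E c where *: "j = k" "chi k \<one> = of_nat D" "chi (k - 1) \<one> = of_nat E" "1 \<le> E" "E < D"
    "chi k y = of_int c" "- int D \<le> c" "c \<le> - 1"
    "int (Coset.order G) = (int D)\<^sup>2 - c * int D"
    by (rule special_partner_of_identity_integral[OF assms])
  have int_form: "chi k \<one> = of_int (int D)" "chi (k - 1) \<one> = of_int (int E)"
    "(of_nat (Coset.order G) :: complex) = of_int (int (Coset.order G))"
    using *(2,3) by simp_all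
  have "int D \<le> - c * int D" "- c * int D \<le> int D * int D"
    using mult_right_mono[of 1 "- c" "int D"] mult_right_mono[of "- c" "int D" "int D"] *(7,8) by simp_all
  then have bounds: "(int D)\<^sup>2 + int D \<le> int (Coset.order G)" "int (Coset.order G) \<le> 2 * (int D)\<^sup>2"
    unfolding *(9) by (simp_all add: power2_eq_square)
  have kernel: "{\<one>} \<union> conj_class G y \<subseteq> (\<Inter>i\<in>{1..k - 1}. char_kernel G (chi i))"
  proof (intro subsetI INT_I)
    fix z i assume z: "z \<in> {\<one>} \<union> conj_class G y" and i: "i \<in> {1..k - 1}"
    then have iR: "i \<in> {1..k} - {j}" using *(1) by auto
    then have Irr: "chi i \<in> Irr G" using Irr_enumerationD(3)[OF enum] by blast
    have "chi i y = chi i \<one>" using agree iR by blast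
    then have "z \<in> carrier G \<and> chi i z = chi i \<one>"
      using z Irr_conj_class[OF Irr y, of z] by auto
    then show "z \<in> char_kernel G (chi i)" by (simp add: char_kernel_def)
  qed
  have "chi (k - 1) \<one> < chi k \<one>" "1 \<le> chi (k - 1) \<one>" "- chi k \<one> \<le> chi k y" "chi k y \<le> - 1"
    using of_int_less_complex_iff[of "int E" "int D"] of_int_le_complex_iff[of 1 "int E"]
      of_int_le_complex_iff[of "- int D" c] of_int_le_complex_iff[of c "- 1"] *(4,5,7,8)
    unfolding int_form *(6) by simp_all
  moreover have "of_nat (Coset.order G) = (chi k \<one>)\<^sup>2 - chi k y * chi k \<one>"
    unfolding int_form *(6,9) by simp
  moreover have "(chi k \<one>)\<^sup>2 + chi k \<one> \<le> of_nat (Coset.order G)" "of_nat (Coset.order G) \<le> 2 * (chi k \<one>)\<^sup>2"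
    using bounds of_int_le_complex_iff[of "(int D)\<^sup>2 + int D" "int (Coset.order G)"]
      of_int_le_complex_iff[of "int (Coset.order G)" "2 * (int D)\<^sup>2"]
    unfolding int_form by simp_all
  moreover have "chi k y \<in> \<int>" using *(6) by simp
  ultimately show ?thesis using *(1) kernel by blast
qed

theorem lemma2p1:
  fixes G :: "('g, 'm) monoid_scheme"
    and chi :: "nat \<Rightarrow> 'g \<Rightarrow> complex"
    and k j :: nat
    and a b :: 'g
  assumes "CD1_group G"
    and "Irr_enumeration G k chi"
    and "a \<in> carrier G" and "b \<in> carrier G"
    and "j \<in> {1..k}"
    and "chi j a \<noteq> chi j b"
    and "\<forall>i\<in>{1..k} - {j}. chi i a = chi i b"
  shows "(conj_class G a = {\<one>\<^bsub>G\<^esub>} \<or> conj_class G b = {\<one>\<^bsub>G\<^esub>}) \<and>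
    (\<forall>x y. (x = a \<and> y = b \<or> x = b \<and> y = a) \<and> x = \<one>\<^bsub>G\<^esub> \<longrightarrow>
       (\<forall>i\<in>{1..k}. chi i x = chi i \<one>\<^bsub>G\<^esub>) \<and>
       j = k \<and>
       chi (k - 1) x < chi k x \<and> 1 \<le> chi (k - 1) x \<and>
       chi k y \<in> \<int> \<and> - chi k x \<le> chi k y \<and> chi k y \<le> - 1 \<and>
       of_nat (Coset.order G) = (chi k x)\<^sup>2 - chi k y * chi k x \<and>
       (chi k x)\<^sup>2 + chi k x \<le> of_nat (Coset.order G) \<and>
       of_nat (Coset.order G) \<le> 2 * (chi k x)\<^sup>2 \<and>
       {\<one>\<^bsub>G\<^esub>} \<union> conj_class G y \<subseteq> (\<Inter>i\<in>{1..k - 1}. char_kernel G (chi i)))"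
proof -
  interpret group G using assms(1) by (simp add: CD1_group_def)
  have fin: "finite (carrier G)" and large: "Coset.order G > 2"
    using assms(1) by (simp_all add: CD1_group_def)
  have pair: "conj_class G a = {\<one>\<^bsub>G\<^esub>} \<or> conj_class G b = {\<one>\<^bsub>G\<^esub>}"
    using special_pair_contains_identity[OF fin assms(2-7)] conj_class_one by auto
  show ?thesis
  proof (rule conjI[OF pair], intro allI impI, elim conjE)
    fix x y assume xy: "x = a \<and> y = b \<or> x = b \<and> y = a" and x1: "x = \<one>\<^bsub>G\<^esub>"
    have agree: "\<forall>i\<in>{1..k} - {j}. chi i y = chi i x"
    proof
      fix i assume "i \<in> {1..k} - {j}"
      then have "chi i a = chi i b" using assms(7) by blast
      then show "chi i y = chi i x" using xy by auto
    qed
    have y: "y \<in> carrier G" and differ: "chi j x \<noteq> chi j y" using xy assms(3,4,6) by auto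
    have "\<forall>i\<in>{1..k}. chi i \<one>\<^bsub>G\<^esub> = chi i \<one>\<^bsub>G\<^esub>" by simp
    then show "(\<forall>i\<in>{1..k}. chi i x = chi i \<one>\<^bsub>G\<^esub>) \<and>
       j = k \<and>
       chi (k - 1) x < chi k x \<and> 1 \<le> chi (k - 1) x \<and>
       chi k y \<in> \<int> \<and> - chi k x \<le> chi k y \<and> chi k y \<le> - 1 \<and>
       of_nat (Coset.order G) = (chi k x)\<^sup>2 - chi k y * chi k x \<and>
       (chi k x)\<^sup>2 + chi k x \<le> of_nat (Coset.order G) \<and>
       of_nat (Coset.order G) \<le> 2 * (chi k x)\<^sup>2 \<and>
       {\<one>\<^bsub>G\<^esub>} \<union> conj_class G y \<subseteq> (\<Inter>i\<in>{1..k - 1}. char_kernel G (chi i))"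
      unfolding x1
      using special_partner_of_identity
        [OF fin large assms(2) y assms(5) differ[unfolded x1] agree[unfolded x1]]
      by (rule conjI)
  qed
qed

end
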